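(* Let $1\le r\le n-1$ and $A\in\mathbb{R}^{n\times n}$. Suppose that there exists $m\in\{r,\dots,n-1\}$ such that $|\lambda_m[A]|>|\lambda_{m+1}[A]|$. If $U[0]\in\mathcal{V}_{m,r}^{\rm (d)}$, then the solution $U[k]$ of the natural power method $$U[k+1]=AU[k]\,(U[k]^{\top}A^{\top}AU[k])^{-1/2},\qquad k\ge 0,$$ converges, as $k\to\infty$, to the invariant set $$\mathcal{U}_{m,r}^{\rm (d)}:=\left\{\Psi[A]\begin{bmatrix} K_{m,r} \\ 0_{n-m,r} \end{bmatrix}\in\mathrm{St}(r,n)\ \middle|\ K_{m,r}\in\mathbb{C}^{m\times r},\ \mathrm{rank}(K_{m,r})=r\right\}.$$ (The claim is convergence to the set, i.e. the distance from $U[k]$ to $\mathcal{U}_{m,r}^{\rm (d)}$ tends to $0$; convergence to a single element is not claimed.)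
   Context: $\mathrm{St}(r,n):=\{X\in\mathbb{R}^{n\times r}\mid X^{\top}X=I_r\}$ is the (real) Stiefel manifold. $0_{p,q}$ is the $p\times q$ zero matrix. For a symmetric positive semidefinite matrix $X$, $X^{1/2}$ is its unique positive semidefinite square root, and $X^{-1/2}$ is the inverse of $X^{1/2}$ when $X$ is non-singular. The eigenvalues of a square matrix $A$ (with algebraic multiplicity) are ordered so that $|\lambda_1[A]|\ge\dots\ge|\lambda_n[A]|$. $\psi_i[A]$ denotes the corresponding normalized right (generalized) eigenvector, and $\Psi[A]:=[\psi_1[A],\dots,\psi_n[A]]\in\mathbb{C}^{n\times n}$. This is a non-singular matrix whose columns form Jordan chains of $A$, so that $\Psi[A]^{-1}A\Psi[A]$ is block diagonal. In particular, when $|\lambda_m[A]|>|\lambda_{m+1}[A]|$, the first $m$ columns span the sum of the generalized eigenspaces for $\lambda_1[A],\dots,\lambda_m[A]$ and the last $n-m$ columns span the sum of those for $\lambda_{m+1}[A],\dots,\lambda_n[A]$. The set of admissible initial conditions is $$\mathcal{V}_{m,r}^{\rm (d)}:=\left\{\Psi[A]\begin{bmatrix} K_{m,r} \\ K_{\perp} \end{bmatrix}\in\mathrm{St}(r,n)\ \middle|\ K_{m,r}\in\mathbb{C}^{m\times r},\ K_{\perp}\in\mathbb{C}^{(n-m)\times r},\ \mathrm{rank}(K_{m,r})=r\right\}.$$ A set is invariant if an iterate starting in the set remains in it. *)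

theory Defs
  imports
    "Jordan_Normal_Form.Char_Poly"
    "Jordan_Normal_Form.DL_Rank"
    "Jordan_Normal_Form.Gauss_Jordan_Elimination"
    Complex_Main
begin

definition stiefel :: "nat \<Rightarrow> nat \<Rightarrow> real mat set" where
  "stiefel r n = {X \<in> carrier_mat n r. X\<^sup>T * X = 1\<^sub>m r}"

definition psd_mat :: "nat \<Rightarrow> real mat \<Rightarrow> bool" where
  "psd_mat n X \<longleftrightarrow> X \<in> carrier_mat n n \<and> X\<^sup>T = X \<and>
     (\<forall>v \<in> carrier_vec n. 0 \<le> v \<bullet> (X *\<^sub>v v))"

text \<open>The square root is meaningful for positive semidefinite arguments, and the
  inverse square root moreover only for non-singular ones; elsewhere the values are
  unspecified.\<close>

definition mat_sqrt :: "real mat \<Rightarrow> real mat" where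
  "mat_sqrt X = (THE S. psd_mat (dim_row X) S \<and> S * S = X)"

definition mat_inv_sqrt :: "real mat \<Rightarrow> real mat" where
  "mat_inv_sqrt X = the (mat_inverse (mat_sqrt X))"

text \<open>Indices are shifted by one with respect to the usual numbering
  \<open>\<lambda>\<^sub>1, \<dots>, \<lambda>\<^sub>n\<close>: the entry \<open>l ! i\<close> is the eigenvalue \<open>\<lambda>\<^sub>i\<^sub>+\<^sub>1\<close>, and likewise
  \<open>col \<Psi> i\<close> is \<open>\<psi>\<^sub>i\<^sub>+\<^sub>1\<close>.  The factorization of the characteristic polynomial
  accounts for algebraic multiplicity.\<close>

definition ordered_eigenvalues :: "complex mat \<Rightarrow> complex list \<Rightarrow> bool" where
  "ordered_eigenvalues A l \<longleftrightarrow>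
     char_poly A = (\<Prod>a\<leftarrow>l. [:- a, 1:]) \<and>
     (\<forall>i j. i \<le> j \<and> j < length l \<longrightarrow> cmod (l ! j) \<le> cmod (l ! i))"

text \<open>A matrix of unit-norm generalized eigenvectors whose columns, in the order of
  the eigenvalue list \<open>l\<close>, split into consecutive Jordan chains.  Each column is
  either an eigenvector (starting a chain) or is mapped by \<open>A - \<lambda> I\<close> to a non-zero
  multiple of its predecessor for the same eigenvalue.  The multiple \<open>c\<close> cannot be
  fixed to \<open>1\<close>, because all columns of a chain are normalized.  Neither \<open>l\<close> nor \<open>P\<close>
  is unique; results are to be stated for every choice.\<close>

definition jordan_eigenbasis ::
    "nat \<Rightarrow> complex mat \<Rightarrow> complex list \<Rightarrow> complex mat \<Rightarrow> bool" where
  "jordan_eigenbasis n A l P \<longleftrightarrow>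
     P \<in> carrier_mat n n \<and> invertible_mat P \<and>
     (\<forall>i<n. col P i \<bullet>c col P i = 1) \<and>
     (\<forall>i<n. A *\<^sub>v col P i = l ! i \<cdot>\<^sub>v col P i \<or>
        (0 < i \<and> l ! i = l ! (i - 1) \<and>
         (\<exists>c. c \<noteq> 0 \<and> A *\<^sub>v col P i = l ! i \<cdot>\<^sub>v col P i + c \<cdot>\<^sub>v col P (i - 1))))"

text \<open>Membership of the complex product in the real Stiefel manifold is expressed by
  requiring it to be the embedding of a real matrix there.  The operation \<open>@\<^sub>r\<close> stacks
  matrices vertically; the dimension argument of the rank constant is the number of
  rows.\<close>

definition admissible_set ::
    "complex mat \<Rightarrow> nat \<Rightarrow> nat \<Rightarrow> nat \<Rightarrow> real mat set" where
  "admissible_set P n m r = {X \<in> stiefel r n. \<exists>K K'.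
     K \<in> carrier_mat m r \<and> K' \<in> carrier_mat (n - m) r \<and> vec_space.rank m K = r \<and>
     map_mat complex_of_real X = P * (K @\<^sub>r K')}"

definition limit_set ::
    "complex mat \<Rightarrow> nat \<Rightarrow> nat \<Rightarrow> nat \<Rightarrow> real mat set" where
  "limit_set P n m r = {X \<in> stiefel r n. \<exists>K.
     K \<in> carrier_mat m r \<and> vec_space.rank m K = r \<and>
     map_mat complex_of_real X = P * (K @\<^sub>r 0\<^sub>m (n - m) r)}"

definition natural_power_solution :: "real mat \<Rightarrow> (nat \<Rightarrow> real mat) \<Rightarrow> bool" where
  "natural_power_solution A U \<longleftrightarrow>
     (\<forall>k. U (Suc k) = A * U k * mat_inv_sqrt ((U k)\<^sup>T * A\<^sup>T * A * U k))"

definition invariant_set :: "real mat \<Rightarrow> real mat set \<Rightarrow> bool" where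
  "invariant_set A S \<longleftrightarrow>
     (\<forall>U. natural_power_solution A U \<and> U 0 \<in> S \<longrightarrow> (\<forall>k. U k \<in> S))"

definition frob_norm :: "real mat \<Rightarrow> real" where
  "frob_norm X = sqrt (\<Sum>i<dim_row X. \<Sum>j<dim_col X. (X $$ (i, j))\<^sup>2)"

text \<open>Non-emptiness is required because the infimum of the empty set of reals is
  unspecified.\<close>

definition converges_to_set :: "(nat \<Rightarrow> real mat) \<Rightarrow> real mat set \<Rightarrow> bool" where
  "converges_to_set U S \<longleftrightarrow>
     S \<noteq> {} \<and> (\<lambda>k. INF V\<in>S. frob_norm (U k - V)) \<longlonglongrightarrow> 0"

end

theory Submission
  imports Defs "Jordan_Normal_Form.Schur_Decomposition"
begin

text \<open>In the coordinates given by \<open>P\<close>, the matrix \<open>A\<close> is upper bidiagonal, and the modulus gap makes it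
  block diagonal with blocks of sizes \<open>m\<close> and \<open>n - m\<close>.  Full rank of \<open>K\<close> means that the column
  space of \<open>U 0\<close> lies in the graph of a linear map \<open>Z\<close> from the dominant to the remaining
  coordinates, and the iteration replaces \<open>Z\<close> by \<open>J\<^sub>2 Z J\<^sub>1\<^sup>-\<^sup>1\<close>, where \<open>J\<^sub>1\<close> and \<open>J\<^sub>2\<close> are
  the two blocks.  Each entry of \<open>Z\<close> obeys a scalar recurrence with factor \<open>l ! i / l ! j\<close> of modulus
  less than one, perturbed by entries already known to vanish in the limit; so \<open>Z\<close> tends to zero.
  The limit set is the case \<open>Z = 0\<close>, which is preserved.

  To find a nearby point of the limit set, drop the last \<open>n - m\<close> coordinates of \<open>U k\<close>, take real
  parts, and pass to the orthogonal polar factor.  Taking real parts is harmless because the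
  dominant subspace is closed under complex conjugation.\<close>

section \<open>Square roots of positive semidefinite matrices\<close>

text \<open>Over the complex numbers a root of the characteristic polynomial exists. Symmetry moves
  the matrix across the Hermitian product, so that root equals its conjugate and is a root of the
  real characteristic polynomial.\<close>

lemma real_symmetric_mat_eigenvector:
  fixes A :: "real mat"
  assumes A: "A \<in> carrier_mat n n" and sym: "A\<^sup>T = A" and n: "0 < n"
  shows "\<exists>v e. eigenvector A v e"
proof -
  let ?C = "map_mat complex_of_real A"
  have C: "?C \<in> carrier_mat n n" using A by simp
  obtain as where as: "char_poly ?C = (\<Prod>a\<leftarrow>as. [:- a, 1:])" "length as = n"
    using char_poly_factorized[OF C] by blast
  obtain \<mu> where mu: "\<mu> \<in> set as" using as(2) n by (cases as) auto
  have root: "poly (char_poly ?C) \<mu> = 0"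
    unfolding as(1) using mu by (auto simp: poly_prod_list prod_list_zero_iff)
  then obtain x where x: "eigenvector ?C x \<mu>"
    using eigenvalue_root_char_poly[OF C] unfolding eigenvalue_def by blast
  have xc: "x \<in> carrier_vec n" and x0: "x \<noteq> 0\<^sub>v n" and Cx: "?C *\<^sub>v x = \<mu> \<cdot>\<^sub>v x"
    using x C unfolding eigenvector_def by auto
  have xc': "conjugate x \<in> carrier_vec n" using xc by simp
  have conj: "conjugate (?C *\<^sub>v x) = ?C *\<^sub>v conjugate x"
    by (rule eq_vecI) (use A xc in \<open>auto simp: scalar_prod_def\<close>)
  have "\<mu> * (x \<bullet>c x) = (?C *\<^sub>v x) \<bullet>c x" unfolding Cx using xc by simp
  also have "\<dots> = x \<bullet> (?C *\<^sub>v conjugate x)"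
  proof -
    have "?C\<^sup>T = map_mat complex_of_real (A\<^sup>T)" by (rule eq_matI) auto
    then have "?C\<^sup>T = ?C" using sym by simp
    moreover have "(?C\<^sup>T *\<^sub>v x) \<bullet>c x = x \<bullet> (?C *\<^sub>v conjugate x)"
      by (rule transpose_vec_mult_scalar[OF C xc' xc])
    ultimately show ?thesis by simp
  qed
  also have "\<dots> = cnj \<mu> * (x \<bullet>c x)" unfolding conj[symmetric] Cx using xc by (simp add: conjugate_smult_vec)
  finally have "\<mu> = cnj \<mu>" using x0 xc by simp
  then have re: "\<mu> = complex_of_real (Re \<mu>)" by (simp add: complex_eq_iff)
  \<comment> \<open>The real eigenvector comes from this real root, not from the complex vector
    \<open>x\<close>.\<close>
  have "complex_of_real (poly (char_poly A) (Re \<mu>)) = 0"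
    using root unfolding of_real_hom.char_poly_hom[OF A] 
    by (metis re of_real_hom.poly_map_poly)
  then have "eigenvalue A (Re \<mu>)" using eigenvalue_root_char_poly[OF A] by simp
  then show ?thesis unfolding eigenvalue_def by blast
qed

text \<open>Complete \<open>v\<close> to a basis and orthogonalize; Gram-Schmidt keeps the first
  vector, and normalizing the columns only rescales it.\<close>

lemma orthogonal_mat_with_first_col:
  fixes v :: "real vec"
  assumes v: "v \<in> carrier_vec n" and v0: "v \<noteq> 0\<^sub>v n"
  shows "\<exists>W c. W \<in> carrier_mat n n \<and> W\<^sup>T * W = 1\<^sub>m n \<and> col W 0 = c \<cdot>\<^sub>v v"
proof -
  interpret cof_vec_space n "TYPE(real)" .
  note b = basis_completion[OF v v0]
  define ws where "ws = gram_schmidt n (basis_completion v)"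
  note g = gram_schmidt_result[OF b(2) b(4) b(5) ws_def]
  have n: "0 < n" using v v0 by (cases n) auto
  have len: "length ws = n" using g(4) b(6) by simp
  have hd: "ws ! 0 = v"
  proof -
    have "hd ws = v" unfolding ws_def using b(7) b(6) n gram_schmidt_hd[OF v]
      by (cases "basis_completion v") auto
    then show ?thesis using len n by (metis hd_conv_nth length_greater_0_conv)
  qed
  have wc: "ws ! i \<in> carrier_vec n" if "i < n" for i using g(3) len that by auto
  have orth: "ws ! i \<bullet> ws ! j = 0 \<longleftrightarrow> i \<noteq> j" if "i < n" "j < n" for i j
    using corthogonalD[OF g(2)] that len by simp
  define c where "c = (\<lambda>i. 1 / sqrt (ws ! i \<bullet> ws ! i))"
  define W where "W = mat_of_cols n (map (\<lambda>i. c i \<cdot>\<^sub>v ws ! i) [0..<n])"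
  have W: "W \<in> carrier_mat n n" unfolding W_def by (rule carrier_matI) simp_all
  have col: "col W i = c i \<cdot>\<^sub>v ws ! i" if "i < n" for i
    unfolding W_def using that wc[OF that] by (subst col_mat_of_cols) auto
  have "W\<^sup>T * W = 1\<^sub>m n"
  proof (rule eq_matI)
    fix i j assume "i < dim_row (1\<^sub>m n)" "j < dim_col (1\<^sub>m n)"
    then have ij: "i < n" "j < n" by auto
    have "(W\<^sup>T * W) $$ (i, j) = c i * c j * (ws ! i \<bullet> ws ! j)"
      using W ij wc[OF ij(1)] wc[OF ij(2)] by (simp add: col)
    also have "\<dots> = 1\<^sub>m n $$ (i, j)"
    proof (cases "i = j")
      case True
      have "ws ! i \<bullet> ws ! i > 0"
        using orth[OF ij(1) ij(1)] conjugate_square_ge_0_vec[of "ws ! i"] by simp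
      then show ?thesis using True ij by (simp add: c_def)
    qed (use ij orth in auto)
    finally show "(W\<^sup>T * W) $$ (i, j) = 1\<^sub>m n $$ (i, j)" .
  qed (use W in auto)
  then show ?thesis using W col[OF n] hd by auto
qed

text \<open>Deflation: in an orthonormal basis starting with an eigenvector, the first column is
  cleared below the diagonal and, by symmetry, so is the first row. The induction hypothesis applies
  to the remaining block.\<close>

lemma real_symmetric_mat_diagonalization:
  fixes A :: "real mat"
  assumes "A \<in> carrier_mat n n" and "A\<^sup>T = A"
  shows "\<exists>W. W \<in> carrier_mat n n \<and> W\<^sup>T * W = 1\<^sub>m n \<and> diagonal_mat (W\<^sup>T * A * W)"
  using assms
proof (induction n arbitrary: A)
  case 0
  then show ?case by (intro exI[of _ "1\<^sub>m 0"]) (auto simp: diagonal_mat_def)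
next
  case (Suc n)
  obtain v e where ev: "eigenvector A v e" using real_symmetric_mat_eigenvector[OF Suc.prems] by auto
  note A = Suc.prems(1)
  have v: "v \<in> carrier_vec (Suc n)" "v \<noteq> 0\<^sub>v (Suc n)" "A *\<^sub>v v = e \<cdot>\<^sub>v v"
    using ev A unfolding eigenvector_def by auto
  obtain W c where W: "W \<in> carrier_mat (Suc n) (Suc n)" and WW: "W\<^sup>T * W = 1\<^sub>m (Suc n)"
    and W0: "col W 0 = c \<cdot>\<^sub>v v" using orthogonal_mat_with_first_col[OF v(1,2)] by blast
  define B where "B = W\<^sup>T * A * W"
  have B: "B \<in> carrier_mat (Suc n) (Suc n)" unfolding B_def using A W by auto
  have Bsym: "B\<^sup>T = B" unfolding B_def using A W Suc.prems(2)
    by (simp add: transpose_mult[of _ "Suc n" "Suc n" _ "Suc n"] assoc_mult_mat[of _ "Suc n" "Suc n" _ "Suc n" _ "Suc n"])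
  have B0: "B $$ (i, 0) = (if i = 0 then e else 0)" if "i < Suc n" for i
  proof -
    have "B $$ (i, 0) = (W\<^sup>T * (A * W)) $$ (i, 0)"
      unfolding B_def using A W by (simp add: assoc_mult_mat[of _ "Suc n" "Suc n" _ "Suc n" _ "Suc n"])
    also have "\<dots> = col W i \<bullet> (A *\<^sub>v col W 0)" using A W that by (subst index_mult_mat) (auto simp: mult_mat_vec_def)
    also have "A *\<^sub>v col W 0 = e \<cdot>\<^sub>v col W 0" unfolding W0 using A v
      by (simp add: mult_mat_vec smult_smult_assoc mult.commute)
    also have "col W i \<bullet> (e \<cdot>\<^sub>v col W 0) = e * (W\<^sup>T * W) $$ (i, 0)" using W that by simp
    finally show ?thesis unfolding WW using that by simp
  qed
  have B0': "B $$ (0, i) = (if i = 0 then e else 0)" if "i < Suc n" for i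
    using B0[OF that] Bsym B that by (metis carrier_matD index_transpose_mat(1) zero_less_Suc)
  define A' where "A' = mat n n (\<lambda>(i, j). B $$ (Suc i, Suc j))"
  have A': "A' \<in> carrier_mat n n" unfolding A'_def by simp
  have "A'\<^sup>T = A'"
  proof (rule eq_matI)
    fix i j assume "i < dim_row A'" "j < dim_col A'"
    then have ij: "i < n" "j < n" unfolding A'_def by auto
    have "B $$ (Suc j, Suc i) = B\<^sup>T $$ (Suc i, Suc j)" using B ij by simp
    then show "A'\<^sup>T $$ (i, j) = A' $$ (i, j)" unfolding Bsym using ij by (simp add: A'_def)
  qed (auto simp: A'_def)
  from Suc.IH[OF A' this] obtain V where V: "V \<in> carrier_mat n n" "V\<^sup>T * V = 1\<^sub>m n"
    and dV: "diagonal_mat (V\<^sup>T * A' * V)" by blast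
  define E where "E = mat 1 1 (\<lambda>_. e)"
  have Bblk: "B = four_block_mat E (0\<^sub>m 1 n) (0\<^sub>m n 1) A'"
    by (rule eq_matI) (use B B0 B0' in \<open>auto simp: E_def A'_def\<close>)
  define V' where "V' = four_block_mat (1\<^sub>m 1) (0\<^sub>m 1 n) (0\<^sub>m n 1) V"
  have V': "V' \<in> carrier_mat (Suc n) (Suc n)" unfolding V'_def using V
    by (metis four_block_carrier_mat one_carrier_mat plus_1_eq_Suc)
  have V'T: "V'\<^sup>T = four_block_mat (1\<^sub>m 1) (0\<^sub>m 1 n) (0\<^sub>m n 1) V\<^sup>T"
    unfolding V'_def using V by (subst transpose_four_block_mat[of _ 1 1 _ n _ n]) auto
  have E: "E \<in> carrier_mat 1 1" unfolding E_def by simp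
  have VV: "V'\<^sup>T * V' = 1\<^sub>m (Suc n)"
    unfolding V'T unfolding V'_def using V by (subst mult_four_block_mat[of _ 1 1 _ n _ n _ _ 1 _ n]) auto
  have VBV: "V'\<^sup>T * B * V' = four_block_mat E (0\<^sub>m 1 n) (0\<^sub>m n 1) (V\<^sup>T * A' * V)"
    unfolding V'T Bblk unfolding V'_def using V A' E
    by (subst mult_four_block_mat[of _ 1 1 _ n _ n _ _ 1 _ n], auto)+
  have "W * V' \<in> carrier_mat (Suc n) (Suc n)" using W V' by auto
  moreover have "(W * V')\<^sup>T * (W * V') = 1\<^sub>m (Suc n)"
  proof -
    have "(W * V')\<^sup>T * (W * V') = V'\<^sup>T * (W\<^sup>T * W) * V'" using W V'
      by (simp add: transpose_mult[of _ "Suc n" "Suc n" _ "Suc n"] assoc_mult_mat[of _ "Suc n" "Suc n" _ "Suc n" _ "Suc n"])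
    then show ?thesis unfolding WW using V' VV by simp
  qed
  moreover have "diagonal_mat ((W * V')\<^sup>T * A * (W * V'))"
  proof -
    have "(W * V')\<^sup>T * A * (W * V') = V'\<^sup>T * B * V'" unfolding B_def using W V' A
      by (simp add: transpose_mult[of _ "Suc n" "Suc n" _ "Suc n"] assoc_mult_mat[of _ "Suc n" "Suc n" _ "Suc n" _ "Suc n"])
    moreover have "diagonal_mat (four_block_mat E (0\<^sub>m 1 n) (0\<^sub>m n 1) (V\<^sup>T * A' * V))"
      unfolding diagonal_mat_def
    proof (intro allI impI)
      fix i j
      assume ij: "i < dim_row (four_block_mat E (0\<^sub>m 1 n) (0\<^sub>m n 1) (V\<^sup>T * A' * V))"
        "j < dim_col (four_block_mat E (0\<^sub>m 1 n) (0\<^sub>m n 1) (V\<^sup>T * A' * V))" "i \<noteq> j"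
      then have "i < Suc n" "j < Suc n" using E V A' by auto
      then show "four_block_mat E (0\<^sub>m 1 n) (0\<^sub>m n 1) (V\<^sup>T * A' * V) $$ (i, j) = 0"
        using ij(3) dV E V A' by (cases i; cases j) (auto simp: diagonal_mat_def)
    qed
    ultimately show ?thesis unfolding VBV by simp
  qed
  ultimately show ?case by blast
qed

section \<open>Existence and uniqueness of the positive semidefinite square root\<close>

text \<open>At \<open>v + t \<cdot>\<^sub>v w\<close> with \<open>w = S *\<^sub>v v\<close>, the
  quadratic form is a polynomial in \<open>t\<close> without constant term, whose linear coefficient
  is twice \<open>w \<bullet> w\<close>. It stays nonnegative for small negative \<open>t\<close>
  only if \<open>w\<close> vanishes.\<close>

lemma psd_mat_zero_form:
  assumes S: "psd_mat n S" and v: "v \<in> carrier_vec n" and z: "v \<bullet> (S *\<^sub>v v) = 0"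
  shows "S *\<^sub>v v = 0\<^sub>v n"
proof -
  have Sc: "S \<in> carrier_mat n n" and sym: "S\<^sup>T = S"
    and pos: "\<And>v. v \<in> carrier_vec n \<Longrightarrow> 0 \<le> v \<bullet> (S *\<^sub>v v)" using S unfolding psd_mat_def by auto
  define w where "w = S *\<^sub>v v"
  have w: "w \<in> carrier_vec n" unfolding w_def using Sc v by simp
  have Sw: "S *\<^sub>v w \<in> carrier_vec n" using Sc w by simp
  have vSw: "v \<bullet> (S *\<^sub>v w) = w \<bullet> w"
    using transpose_vec_mult_scalar[OF Sc w v] unfolding sym w_def[symmetric] by simp
  have *: "0 \<le> 2 * t * (w \<bullet> w) + t * t * (w \<bullet> (S *\<^sub>v w))" for t :: real
  proof -
    have "S *\<^sub>v (v + t \<cdot>\<^sub>v w) = w + t \<cdot>\<^sub>v (S *\<^sub>v w)"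
      using Sc v w by (simp add: mult_add_distrib_mat_vec w_def mult_mat_vec)
    then have "(v + t \<cdot>\<^sub>v w) \<bullet> (S *\<^sub>v (v + t \<cdot>\<^sub>v w)) = 2 * t * (w \<bullet> w) + t * t * (w \<bullet> (S *\<^sub>v w))"
      using v w Sw z vSw
      by (simp add: add_scalar_prod_distrib[of _ n] scalar_prod_add_distrib[of _ n] w_def[symmetric] algebra_simps)
    then show ?thesis using pos[of "v + t \<cdot>\<^sub>v w"] v w by simp
  qed
  define a where "a = w \<bullet> w"
  define b where "b = w \<bullet> (S *\<^sub>v w)"
  have a0: "0 \<le> a" unfolding a_def using conjugate_square_ge_0_vec[of w] by simp
  have b0: "0 \<le> b" unfolding b_def using pos[OF w] .
  have "a = 0"
  proof (rule ccontr)
    assume "a \<noteq> 0"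
    then have a: "0 < a" using a0 by simp
    \<comment> \<open>For this negative \<open>t\<close> the factor \<open>2 * a + t * b\<close> is
      at least \<open>a\<close>, hence positive; adding 1 to \<open>b\<close> avoids a zero
      denominator.\<close>
    define t where "t = - a / (b + 1)"
    have "0 \<le> t * (2 * a + t * b)" using *[of t] unfolding a_def b_def by (simp add: algebra_simps)
    moreover have "t < 0" unfolding t_def using a b0 by (simp add: divide_neg_pos)
    ultimately have "2 * a + t * b \<le> 0" by (simp add: zero_le_mult_iff)
    moreover have "a * b / (b + 1) \<le> a" using a b0 by (simp add: field_simps)
    ultimately show False using a unfolding t_def by simp
  qed
  then show ?thesis using conjugate_square_eq_0_vec[OF w] unfolding a_def w_def by simp
qed

lemma psd_mat_gram:
  assumes B: "B \<in> carrier_mat n r"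
  shows "psd_mat r (B\<^sup>T * B)"
proof -
  have "0 \<le> v \<bullet> (B\<^sup>T * B *\<^sub>v v)" if v: "v \<in> carrier_vec r" for v
  proof -
    have Bv: "B *\<^sub>v v \<in> carrier_vec n" using B v by simp
    have "v \<bullet> (B\<^sup>T * B *\<^sub>v v) = (B\<^sup>T *\<^sub>v (B *\<^sub>v v)) \<bullet> v"
      using B v Bv by (simp add: comm_scalar_prod[of _ r] assoc_mult_mat_vec[of _ r n _ r])
    also have "\<dots> = (B *\<^sub>v v) \<bullet> (B *\<^sub>v v)" by (rule transpose_vec_mult_scalar[OF B v Bv])
    finally show ?thesis using conjugate_square_ge_0_vec[of "B *\<^sub>v v"] by simp
  qed
  then show ?thesis unfolding psd_mat_def using B
    by (auto simp: transpose_mult[of _ r n _ r])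
qed

text \<open>Diagonalize and take square roots on the diagonal, whose entries are values of the
  quadratic form at the columns of \<open>W\<close> and so nonnegative.\<close>

lemma psd_mat_sqrt_exists:
  assumes X: "psd_mat n X"
  shows "\<exists>S. psd_mat n S \<and> S * S = X"
proof -
  have Xc: "X \<in> carrier_mat n n" and sym: "X\<^sup>T = X"
    and pos: "\<And>v. v \<in> carrier_vec n \<Longrightarrow> 0 \<le> v \<bullet> (X *\<^sub>v v)" using X unfolding psd_mat_def by auto
  note assoc = assoc_mult_mat[of _ n n _ n _ n] mult_carrier_mat[of _ n n _ n]
  note tm = transpose_mult[of _ n n _ n]
  obtain W where W: "W \<in> carrier_mat n n" "W\<^sup>T * W = 1\<^sub>m n" and diag: "diagonal_mat (W\<^sup>T * X * W)"
    using real_symmetric_mat_diagonalization[OF Xc sym] by blast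
  have WWT: "W * W\<^sup>T = 1\<^sub>m n" using W by (intro mat_mult_left_right_inverse[of "W\<^sup>T"]) auto
  define D where "D = W\<^sup>T * X * W"
  have D: "D \<in> carrier_mat n n" unfolding D_def using W Xc by simp
  have Dii: "0 \<le> D $$ (i, i)" if i: "i < n" for i
  proof -
    have "D $$ (i, i) = (W\<^sup>T * (X * W)) $$ (i, i)" unfolding D_def using W Xc by (simp add: assoc)
    also have "\<dots> = col W i \<bullet> (X *\<^sub>v col W i)" using W Xc i by (subst index_mult_mat) (auto simp: mult_mat_vec_def)
    finally show ?thesis using pos[of "col W i"] W i by (metis carrier_matD(1) col_carrier_vec carrier_matD(2) col_dim)
  qed
  have Xeq: "X = W * D * W\<^sup>T"
  proof -
    have "W * D * W\<^sup>T = (W * W\<^sup>T) * X * (W * W\<^sup>T)" unfolding D_def using W Xc by (simp add: assoc)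
    then show ?thesis unfolding WWT using Xc by simp
  qed
  \<comment> \<open>Functional calculus on the diagonal matrix \<open>D\<close>: products of values
    \<open>q p\<close> correspond to pointwise products of functions.\<close>
  define q where "q = (\<lambda>p. mat n n (\<lambda>(i, j). if i = j then p (D $$ (i, i)) else 0 :: real))"
  have qc: "q p \<in> carrier_mat n n" for p unfolding q_def by simp
  have qq: "q p * q p' = q (\<lambda>x. p x * p' x)" for p p'
    by (rule eq_matI) (auto simp: q_def scalar_prod_def if_distrib[of "\<lambda>x. x * _"] if_distrib[of "(*) _"] cong: if_cong)
  have qT: "(q p)\<^sup>T = q p" for p by (rule eq_matI) (auto simp: q_def)
  have qsq: "q (\<lambda>x. sqrt x * sqrt x) = D"
    by (rule eq_matI) (use D Dii diag[folded D_def] in \<open>auto simp: q_def diagonal_mat_def\<close>)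
  define S where "S = W * q sqrt * W\<^sup>T"
  have "S * S = X"
  proof -
    have "S * S = W * q sqrt * (W\<^sup>T * W) * q sqrt * W\<^sup>T"
      unfolding S_def using W(1) qc by (simp add: assoc)
    also have "\<dots> = W * (q sqrt * q sqrt) * W\<^sup>T"
      unfolding W(2) using W(1) qc right_mult_one_mat[of "W * q sqrt" n n] by (simp add: assoc)
    finally show ?thesis unfolding qq qsq Xeq .
  qed
  moreover have "psd_mat n S"
  proof -
    \<comment> \<open>Fourth roots of the eigenvalues exhibit \<open>S\<close> as a Gram matrix,
      which is positive semidefinite.\<close>
    define C where "C = q (\<lambda>x. sqrt (sqrt x)) * W\<^sup>T"
    have C: "C \<in> carrier_mat n n" unfolding C_def using W(1) qc by (simp add: assoc)
    have "q (\<lambda>x. sqrt (sqrt x) * sqrt (sqrt x)) = q sqrt"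
      by (rule eq_matI) (use D Dii in \<open>auto simp: q_def\<close>)
    then have "S = W * (q (\<lambda>x. sqrt (sqrt x)) * q (\<lambda>x. sqrt (sqrt x))) * W\<^sup>T"
      unfolding S_def qq by simp
    also have "\<dots> = C\<^sup>T * C" unfolding C_def using W(1) qc
      by (simp only: tm[OF qc transpose_carrier_mat[THEN iffD2, OF W(1)]] qT transpose_transpose)
        (simp add: assoc)
    finally have "S = C\<^sup>T * C" .
    then show ?thesis using psd_mat_gram[OF C] by simp
  qed
  ultimately show ?thesis by blast
qed

text \<open>With \<open>D = S - T\<close>, the equation \<open>S\<^sup>2 = T\<^sup>2\<close> becomes \<open>S D = - D T\<close>.  The quadratic forms
  of \<open>S\<close> on the columns of \<open>D\<close> add up to the trace of \<open>D S D\<close>, which is the negative of the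
  trace of \<open>D T D\<close>.\<close>

lemma psd_mat_sqrt_unique:
  assumes S: "psd_mat n S" and T: "psd_mat n T" and eq: "S * S = T * T" and det: "det S \<noteq> 0"
  shows "S = T"
proof -
  have Sc: "S \<in> carrier_mat n n" and ST: "S\<^sup>T = S"
    and Spos: "\<And>v. v \<in> carrier_vec n \<Longrightarrow> 0 \<le> v \<bullet> (S *\<^sub>v v)" using S unfolding psd_mat_def by auto
  have Tc: "T \<in> carrier_mat n n" and TT: "T\<^sup>T = T"
    and Tpos: "\<And>v. v \<in> carrier_vec n \<Longrightarrow> 0 \<le> v \<bullet> (T *\<^sub>v v)" using T unfolding psd_mat_def by auto
  note assoc = assoc_mult_mat[of _ n n _ n _ n]
  define D where "D = S - T"
  have D: "D \<in> carrier_mat n n" unfolding D_def using Sc Tc by (simp add: minus_carrier_mat)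
  have DT: "D\<^sup>T = D" unfolding D_def using Sc Tc ST TT by (simp add: transpose_minus)
  define tr where "tr = (\<lambda>M :: real mat. \<Sum>i<n. M $$ (i, i))"
  have tr_comm: "tr (M * N) = tr (N * M)" if "M \<in> carrier_mat n n" "N \<in> carrier_mat n n" for M N
  proof -
    have "tr (M * N) = (\<Sum>i<n. \<Sum>k<n. M $$ (i, k) * N $$ (k, i))"
      unfolding tr_def using that by (intro sum.cong) (auto simp: scalar_prod_def lessThan_atLeast0)
    also have "\<dots> = (\<Sum>k<n. \<Sum>i<n. N $$ (k, i) * M $$ (i, k))"
      by (subst sum.swap) (simp add: mult.commute)
    also have "\<dots> = tr (N * M)"
      unfolding tr_def using that by (intro sum.cong) (auto simp: scalar_prod_def lessThan_atLeast0)
    finally show ?thesis .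
  qed
  have form: "(D * M * D) $$ (i, i) = col D i \<bullet> (M *\<^sub>v col D i)" if "i < n" "M \<in> carrier_mat n n" for i M
  proof -
    have "(D * M * D) $$ (i, i) = (D\<^sup>T * (M * D)) $$ (i, i)" unfolding DT using D that by (simp add: assoc)
    also have "\<dots> = col D i \<bullet> (M *\<^sub>v col D i)" using D that by (subst index_mult_mat) (auto simp: mult_mat_vec_def)
    finally show ?thesis .
  qed
  have c: "col D i \<in> carrier_vec n" for i using D by (metis carrier_matD(1) carrier_vecI col_dim)
  have "D * T = - (S * D)"
  proof -
    have "S * D = S * S - S * T" "D * T = S * T - T * T" unfolding D_def
      using Sc Tc by (simp_all add: mult_minus_distrib_mat minus_mult_distrib_mat)
    then show ?thesis unfolding eq using Sc Tc by (intro eq_matI) auto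
  qed
  have "tr (D * T * D) = tr (D * (D * T))" using tr_comm[of "D * T" D] D Tc by simp
  also have "\<dots> = tr (- (D * S * D))" unfolding \<open>D * T = - (S * D)\<close> using D Sc by (simp add: assoc)
  also have "\<dots> = - tr (D * S * D)" unfolding tr_def using D Sc by (simp add: sum_negf)
  finally have sum0: "tr (D * S * D) + tr (D * T * D) = 0" by simp
  have pS: "0 \<le> (D * S * D) $$ (i, i)" if "i < n" for i using form[OF that Sc] Spos[OF c] by simp
  have pT: "0 \<le> (D * T * D) $$ (i, i)" if "i < n" for i using form[OF that Tc] Tpos[OF c] by simp
  have "tr (D * S * D) = 0"
    using sum0 sum_nonneg[of "{..<n}" "\<lambda>i. (D * S * D) $$ (i, i)"] sum_nonneg[of "{..<n}" "\<lambda>i. (D * T * D) $$ (i, i)"]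
      pS pT unfolding tr_def by fastforce
  \<comment> \<open>Each nonnegative summand vanishes, so \<open>S\<close> annihilates every column
    of \<open>D\<close>; non-singularity of \<open>S\<close> then gives
    \<open>D = 0\<close>.\<close>
  then have z: "(D * S * D) $$ (i, i) = 0" if "i < n" for i
    using pS that unfolding tr_def by (subst (asm) sum_nonneg_eq_0_iff) auto
  have "col D i = 0\<^sub>v n" if "i < n" for i
  proof (rule ccontr)
    assume "col D i \<noteq> 0\<^sub>v n"
    moreover have "S *\<^sub>v col D i = 0\<^sub>v n"
      using psd_mat_zero_form[OF S c] form[OF that Sc] z[OF that] by simp
    ultimately show False using det det_0_iff_vec_prod_zero_field[OF Sc] c by blast
  qed
  then have D0: "D $$ (i, j) = 0" if "i < n" "j < n" for i j
    using that D index_col[of i D j] by simp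
  show ?thesis
  proof (rule eq_matI)
    fix i j assume "i < dim_row T" "j < dim_col T"
    then have "i < n" "j < n" using Tc by auto
    then show "S $$ (i, j) = T $$ (i, j)" using D0[of i j] Sc Tc unfolding D_def by simp
  qed (use Sc Tc in auto)
qed

section \<open>Inverse square roots and polar factors\<close>

text \<open>Resolves the \<open>THE\<close> and \<open>the\<close> in the definitions. The
  determinant of \<open>S\<close> is nonzero because its square is that of \<open>X\<close>; hence
  the square root is unique and invertible.\<close>

lemma mat_inv_sqrt_nonsingular:
  assumes X: "psd_mat n X" and det: "det X \<noteq> 0"
  obtains S where "psd_mat n S" and "S * S = X" and "mat_inv_sqrt X \<in> carrier_mat n n"
    and "S * mat_inv_sqrt X = 1\<^sub>m n" and "mat_inv_sqrt X * S = 1\<^sub>m n"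
    and "(mat_inv_sqrt X)\<^sup>T = mat_inv_sqrt X"
proof -
  have dim: "dim_row X = n" using X unfolding psd_mat_def by auto
  obtain S where S: "psd_mat n S" "S * S = X" using psd_mat_sqrt_exists[OF X] by blast
  have Sc: "S \<in> carrier_mat n n" and ST: "S\<^sup>T = S" using S unfolding psd_mat_def by auto
  have dS: "det S \<noteq> 0" using det det_mult[OF Sc Sc] unfolding S(2) by simp
  have "mat_sqrt X = S" unfolding mat_sqrt_def dim
  proof (rule the_equality)
    show "psd_mat n S \<and> S * S = X" using S by blast
    show "T = S" if "psd_mat n T \<and> T * T = X" for T
      by (rule psd_mat_sqrt_unique[OF S(1) _ _ dS, symmetric]) (use that S(2) in auto)
  qed
  then have R: "mat_inv_sqrt X = the (mat_inverse S)" unfolding mat_inv_sqrt_def by simp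
  obtain R where R': "mat_inverse S = Some R"
  proof (cases "mat_inverse S")
    case None
    then show ?thesis using mat_inverse(1)[OF Sc, of "()"] det_non_zero_imp_unit[OF Sc dS, of "()"] by simp
  qed
  have I: "S * R = 1\<^sub>m n" "R * S = 1\<^sub>m n" "R \<in> carrier_mat n n" using mat_inverse(2)[OF Sc R'] by auto
  have "R\<^sup>T = R"
  proof -
    have "R\<^sup>T * S = 1\<^sub>m n" using arg_cong[OF I(1), of transpose_mat] Sc I(3) ST
      by (simp add: transpose_mult[of _ n n _ n])
    then have "R\<^sup>T = R\<^sup>T * (S * R)" using I by simp
    also have "\<dots> = (R\<^sup>T * S) * R" using I Sc by (simp add: assoc_mult_mat[of _ n n _ n _ n])
    finally show ?thesis using \<open>R\<^sup>T * S = 1\<^sub>m n\<close> I by simp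
  qed
  then show ?thesis using that[OF S] R R' I by simp
qed

text \<open>With \<open>R\<close> the inverse of \<open>S\<close>, the Gram matrix of
  \<open>Y * R\<close> is \<open>R * (S * S) * R\<close>, the identity. This serves twice: for
  \<open>Y = A * U k\<close>, where \<open>V\<close> is the next iterate, and for constructing
  points of the limit set.\<close>

lemma polar_decomposition:
  assumes Y: "Y \<in> carrier_mat n r" and det: "det (Y\<^sup>T * Y) \<noteq> 0"
  defines "V \<equiv> Y * mat_inv_sqrt (Y\<^sup>T * Y)"
  obtains S where "psd_mat r S" and "S * S = Y\<^sup>T * Y" and "V \<in> stiefel r n" and "Y = V * S"
    and "mat_inv_sqrt (Y\<^sup>T * Y) \<in> carrier_mat r r"
proof -
  let ?R = "mat_inv_sqrt (Y\<^sup>T * Y)"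
  obtain S where S: "psd_mat r S" "S * S = Y\<^sup>T * Y" and R: "?R \<in> carrier_mat r r"
    "S * ?R = 1\<^sub>m r" "?R * S = 1\<^sub>m r" "?R\<^sup>T = ?R"
    by (rule mat_inv_sqrt_nonsingular[OF psd_mat_gram[OF Y] det])
  have Sc: "S \<in> carrier_mat r r" using S(1) unfolding psd_mat_def by auto
  have Vc: "V \<in> carrier_mat n r" unfolding V_def using Y R(1) by simp
  have "V\<^sup>T * V = ?R * (Y\<^sup>T * Y) * ?R" unfolding V_def using Y R(1)
    by (simp add: transpose_mult[OF Y R(1)] R(4) assoc_mult_mat[of _ r r _ n _ r] assoc_mult_mat[of _ r r _ r _ r] assoc_mult_mat[of _ r n _ r _ r])
  also have "\<dots> = ?R * (S * S) * ?R" unfolding S(2) ..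
  also have "\<dots> = (?R * S) * (S * ?R)" using R(1) Sc
    by (simp add: assoc_mult_mat[of _ r r _ r _ r] mult_carrier_mat[of _ r r _ r])
  finally have "V\<^sup>T * V = 1\<^sub>m r" unfolding R(2,3) by simp
  then have "V \<in> stiefel r n" unfolding stiefel_def using Vc by simp
  moreover have "Y = V * S" unfolding V_def using Y R(1,3) Sc by (simp add: assoc_mult_mat[of _ n r _ r _ r])
  ultimately show ?thesis using that S R(1) by blast
qed

text \<open>Expanding \<open>|(S + I) d|\<^sup>2\<close> for a column \<open>d\<close> of \<open>S - I\<close> shows that \<open>S + I\<close> does not
  shorten it.\<close>

lemma psd_sqrt_minus_one_bound:
  assumes S: "psd_mat r S" and i: "i < r" and j: "j < r"
  shows "\<bar>S $$ (i, j) - 1\<^sub>m r $$ (i, j)\<bar> \<le> sqrt (\<Sum>a<r. ((S * S) $$ (a, j) - 1\<^sub>m r $$ (a, j))\<^sup>2)"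
proof -
  have Sc: "S \<in> carrier_mat r r" 
    and pos: "\<And>v. v \<in> carrier_vec r \<Longrightarrow> 0 \<le> v \<bullet> (S *\<^sub>v v)" using S unfolding psd_mat_def by auto
  define D where "D = S - 1\<^sub>m r"
  define d where "d = col D j"
  have D: "D \<in> carrier_mat r r" unfolding D_def using Sc by (simp add: minus_carrier_mat)
  have d: "d \<in> carrier_vec r" unfolding d_def using D by (metis carrier_matD(1) carrier_vecI col_dim)
  have Sd: "S *\<^sub>v d \<in> carrier_vec r" using Sc d by simp
  have E: "S * S - 1\<^sub>m r = S * D + D" 
  proof -
    have "S * D = S * S - S" unfolding D_def using Sc by (simp add: mult_minus_distrib_mat)
    then show ?thesis unfolding D_def using Sc by (intro eq_matI) auto
  qed
  have e: "(S * S) $$ (a, j) - 1\<^sub>m r $$ (a, j) = (S *\<^sub>v d + d) $ a" if "a < r" for a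
    using arg_cong[OF E, of "\<lambda>M. M $$ (a, j)"] that j D Sc unfolding d_def by simp
  have "(\<Sum>a<r. ((S * S) $$ (a, j) - 1\<^sub>m r $$ (a, j))\<^sup>2) = (S *\<^sub>v d + d) \<bullet> (S *\<^sub>v d + d)"
    using e d Sd by (simp add: scalar_prod_def power2_eq_square lessThan_atLeast0)
  also have "\<dots> = (S *\<^sub>v d) \<bullet> (S *\<^sub>v d) + 2 * (d \<bullet> (S *\<^sub>v d)) + d \<bullet> d"
    using d Sd comm_scalar_prod[OF Sd d]
    by (simp add: add_scalar_prod_distrib[of _ r] scalar_prod_add_distrib[of _ r])
  finally have "d \<bullet> d \<le> (\<Sum>a<r. ((S * S) $$ (a, j) - 1\<^sub>m r $$ (a, j))\<^sup>2)"
    using pos[OF d] conjugate_square_ge_0_vec[of "S *\<^sub>v d"] by simp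
  moreover have "(d $ i)\<^sup>2 \<le> d \<bullet> d"
  proof -
    have "d \<bullet> d = (\<Sum>a<r. (d $ a)\<^sup>2)" using d by (simp add: scalar_prod_def power2_eq_square lessThan_atLeast0)
    then show ?thesis using i member_le_sum[of i "{..<r}" "\<lambda>a. (d $ a)\<^sup>2"] by simp
  qed
  moreover have "d $ i = S $$ (i, j) - 1\<^sub>m r $$ (i, j)" unfolding d_def D_def using Sc i j by simp
  ultimately show ?thesis by (intro real_le_rsqrt) (simp del: sum.lessThan_Suc)
qed

section \<open>Full column rank\<close>

text \<open>Rank counts the columns as a set, so their distinctness is settled first. Full rank
  forces it by counting a maximal independent set; under injectivity, two equal columns would put a
  difference of unit vectors in the kernel.\<close>

lemma rank_eq_dim_col_iff:
  fixes K :: "'a :: field mat"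
  assumes K: "K \<in> carrier_mat m r"
  shows "vec_space.rank m K = r \<longleftrightarrow> (\<forall>v \<in> carrier_vec r. K *\<^sub>v v = 0\<^sub>v m \<longrightarrow> v = 0\<^sub>v r)"
proof -
  interpret vec_space "TYPE('a)" m .
  have len: "length (cols K) = r" using K by simp
  show ?thesis
  proof
    assume rk: "rank K = r"
    have "distinct (cols K)"
    proof -
      obtain S where S: "maximal S (\<lambda>T. T \<subseteq> set (cols K) \<and> lin_indpt T)"
        using maximal_exists_superset[of "set (cols K)" "\<lambda>T. T \<subseteq> set (cols K) \<and> lin_indpt T" "{}"]
        by (auto simp: lin_dep_def)
      have "card S \<le> card (set (cols K))" using S by (intro card_mono) (auto simp: maximal_def)
      then have "r \<le> card (set (cols K))" using rank_card_indpt[OF K S] rk by simp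
      then show ?thesis using len card_length[of "cols K"] by (intro card_distinct) simp
    qed
    then show "\<forall>v \<in> carrier_vec r. K *\<^sub>v v = 0\<^sub>v m \<longrightarrow> v = 0\<^sub>v r"
      using full_rank_lin_indpt[OF K rk] lin_depI[OF K] by blast
  next
    assume inj: "\<forall>v \<in> carrier_vec r. K *\<^sub>v v = 0\<^sub>v m \<longrightarrow> v = 0\<^sub>v r"
    have "distinct (cols K)" unfolding distinct_conv_nth
    proof (intro allI impI)
      fix i j assume ij: "i < length (cols K)" "j < length (cols K)" "i \<noteq> j"
      then have ij': "i < r" "j < r" using len by auto
      show "cols K ! i \<noteq> cols K ! j"
      proof
        assume "cols K ! i = cols K ! j"
        then have eq: "col K i = col K j" using ij K by simp
        let ?v = "unit_vec r i - unit_vec r j :: 'a vec"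
        have "K *\<^sub>v ?v = col K i - col K j"
        proof (rule eq_vecI)
          fix a assume "a < dim_vec (col K i - col K j)"
          then have a: "a < m" using K by simp
          have "row K a \<bullet> ?v = row K a \<bullet> unit_vec r i - row K a \<bullet> unit_vec r j"
            by (rule scalar_prod_minus_distrib[of _ r]) (use K a in auto)
          then show "(K *\<^sub>v ?v) $ a = (col K i - col K j) $ a" using K a ij' by simp
        qed (use K in simp)
        also have "\<dots> = 0\<^sub>v m" unfolding eq using K by (intro eq_vecI) auto
        finally have "?v = 0\<^sub>v r" using inj by simp
        then have "?v $ i = 0" using ij' by simp
        then show False using ij' ij(3) by simp
      qed
    qed
    then show "rank K = r" using lin_indpt_full_rank[OF K] lin_depE[OF K] inj by metis
  qed
qed

text \<open>With \<open>H\<^sup>T\<close> the conjugate transpose, a kernel vector \<open>v\<close>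
  of \<open>H\<^sup>T * K\<close> has \<open>K *\<^sub>v v\<close> of norm zero. So this Gram matrix
  is invertible, and its inverse times \<open>H\<^sup>T\<close> is a left inverse.\<close>

lemma injective_mat_left_inverse:
  fixes K :: "complex mat"
  assumes K: "K \<in> carrier_mat m r"
    and inj: "\<And>v. v \<in> carrier_vec r \<Longrightarrow> K *\<^sub>v v = 0\<^sub>v m \<Longrightarrow> v = 0\<^sub>v r"
  shows "\<exists>L \<in> carrier_mat r m. L * K = 1\<^sub>m r"
proof -
  define H where "H = map_mat cnj K"
  have H: "H \<in> carrier_mat m r" unfolding H_def using K by simp
  have HK: "H\<^sup>T * K \<in> carrier_mat r r" using H K by simp
  have "det (H\<^sup>T * K) \<noteq> 0"
  proof
    assume "det (H\<^sup>T * K) = 0"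
    then obtain v where v: "v \<in> carrier_vec r" "v \<noteq> 0\<^sub>v r" "H\<^sup>T * K *\<^sub>v v = 0\<^sub>v r"
      using det_0_iff_vec_prod_zero_field[OF HK] by blast
    have Kv: "K *\<^sub>v v \<in> carrier_vec m" using K v by simp
    have "H *\<^sub>v conjugate v = conjugate (K *\<^sub>v v)"
      by (rule eq_vecI) (use K v in \<open>auto simp: H_def scalar_prod_def\<close>)
    then have "(K *\<^sub>v v) \<bullet>c (K *\<^sub>v v) = (H\<^sup>T *\<^sub>v (K *\<^sub>v v)) \<bullet> conjugate v"
      using transpose_vec_mult_scalar[OF H _ Kv, of "conjugate v"] v by simp
    also have "H\<^sup>T *\<^sub>v (K *\<^sub>v v) = 0\<^sub>v r" using v H K by (simp add: assoc_mult_mat_vec[of _ r m _ r])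
    finally have "K *\<^sub>v v = 0\<^sub>v m" using v Kv by simp
    then show False using inj v by blast
  qed
  then have "H\<^sup>T * K \<in> Units (ring_mat TYPE(complex) r ())" by (rule det_non_zero_imp_unit[OF HK])
  then obtain B where "B * (H\<^sup>T * K) = 1\<^sub>m r" and B: "B \<in> carrier_mat r r"
    unfolding Units_def ring_mat_def by auto
  then have "B * H\<^sup>T * K = 1\<^sub>m r" using H K by (simp add: assoc_mult_mat[of _ r r _ m _ r])
  then show ?thesis using B H by (intro bexI[of _ "B * H\<^sup>T"]) auto
qed

section \<open>Graphs under bidiagonal matrices\<close>

text \<open>Once the perturbation is below \<open>d\<close>, the level \<open>e / 2\<close> is the
  fixed point of the map sending \<open>t\<close> to \<open>norm a * t + d\<close>, and what exceeds
  it decays geometrically.\<close>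

lemma contracting_recurrence_tendsto_0:
  fixes x :: "nat \<Rightarrow> 'a :: real_normed_field"
  assumes rec: "\<And>k. x (Suc k) = a * x k + b k" and a: "norm a < 1" and b: "b \<longlonglongrightarrow> 0"
  shows "x \<longlonglongrightarrow> 0"
proof (rule LIMSEQ_I)
  fix e :: real assume e: "0 < e"
  define d where "d = (1 - norm a) * e / 2"
  have d: "0 < d" unfolding d_def using e a by simp
  obtain N where N: "\<And>k. k \<ge> N \<Longrightarrow> norm (b k) < d" using LIMSEQ_D[OF b d] by auto
  have bound: "norm (x (N + k)) \<le> norm a ^ k * norm (x N) + e / 2" for k
  proof (induction k)
    case (Suc k)
    have "norm (x (N + Suc k)) \<le> norm a * norm (x (N + k)) + d"
      using rec[of "N + k"] norm_triangle_ineq[of "a * x (N + k)" "b (N + k)"] N[of "N + k"]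
      by (simp add: norm_mult)
    also have "\<dots> \<le> norm a * (norm a ^ k * norm (x N) + e / 2) + d"
      using Suc by (intro add_right_mono mult_left_mono) auto
    also have "\<dots> = norm a ^ Suc k * norm (x N) + e / 2" unfolding d_def by (simp add: field_simps)
    finally show ?case .
  qed (use e in simp)
  have "(\<lambda>k. norm a ^ k * norm (x N)) \<longlonglongrightarrow> 0"
    using tendsto_mult_right[OF LIMSEQ_power_zero[of "norm a"], of "norm (x N)"] a by simp
  then obtain M where M: "\<And>k. k \<ge> M \<Longrightarrow> norm a ^ k * norm (x N) < e / 2"
    using LIMSEQ_D[of _ 0 "e / 2"] e by force
  show "\<exists>no. \<forall>n\<ge>no. norm (x n - 0) < e"
  proof (intro exI allI impI)
    fix n assume "N + M \<le> n"
    then obtain k where "n = N + k" "k \<ge> M" by (metis add_le_cancel_left le_Suc_ex le_add1 le_trans)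
    then show "norm (x n - 0) < e" using bound[of k] M[of k] by simp
  qed
qed

text \<open>\<open>bidiag\<close> is the action on coordinates of the upper bidiagonal matrix with diagonal \<open>l\<close>
  whose superdiagonal entry in column \<open>j\<close> is \<open>c j\<close>.  Vectors whose coordinates from \<open>m\<close> on are
  given by \<open>Z\<close> applied to the first \<open>m\<close> ones form the graph of \<open>Z\<close>; the bidiagonal matrix maps
  it to the graph of \<open>graph_step Z\<close>, found by forward substitution along the columns.\<close>

locale bidiagonal_gap =
  fixes n m :: nat and l c :: "nat \<Rightarrow> complex"
  assumes m_pos: "0 < m" and m_less: "m < n"
    and gap: "\<And>i j. i < m \<Longrightarrow> m \<le> j \<Longrightarrow> j < n \<Longrightarrow> cmod (l j) < cmod (l i)"
    and c_m: "c m = 0"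
begin

definition bidiag :: "(nat \<Rightarrow> complex) \<Rightarrow> nat \<Rightarrow> complex" where
  "bidiag q i = l i * q i + (if Suc i < n then c (Suc i) * q (Suc i) else 0)"

definition on_graph :: "(nat \<Rightarrow> nat \<Rightarrow> complex) \<Rightarrow> (nat \<Rightarrow> complex) \<Rightarrow> bool" where
  "on_graph Z q \<longleftrightarrow> (\<forall>i. m \<le> i \<and> i < n \<longrightarrow> q i = (\<Sum>j<m. Z i j * q j))"

primrec graph_step :: "(nat \<Rightarrow> nat \<Rightarrow> complex) \<Rightarrow> nat \<Rightarrow> nat \<Rightarrow> complex" where
  "graph_step Z i 0 = bidiag (\<lambda>i. Z i 0) i / l 0"
| "graph_step Z i (Suc j) = (bidiag (\<lambda>i. Z i (Suc j)) i - c (Suc j) * graph_step Z i j) / l (Suc j)"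

lemma l_nonzero: "l i \<noteq> 0" if "i < m"
  using gap[OF that, of m] m_less by auto

text \<open>For rows from \<open>m\<close> on, this is the entrywise form of
  \<open>J\<^sub>2 Z = Y J\<^sub>1\<close> with \<open>Y = graph_step Z\<close>.\<close>

lemma graph_step_mult:
  assumes "j < m"
  shows "l j * graph_step Z i j = bidiag (\<lambda>i. Z i j) i - (if j = 0 then 0 else c j * graph_step Z i (j - 1))"
  using l_nonzero[OF assms] by (cases j) (auto simp: field_simps)

text \<open>If the trailing coordinates are \<open>Z\<close> applied to the leading ones, then
  \<open>J\<^sub>2 Z = Y J\<^sub>1\<close> carries this relation over to the image with
  \<open>Y\<close> in place of \<open>Z\<close>.\<close>

lemma on_graph_step:
  assumes q: "on_graph Z q"
  shows "on_graph (graph_step Z) (bidiag q)"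
  unfolding on_graph_def
proof (intro allI impI)
  fix i assume i: "m \<le> i \<and> i < n"
  let ?Y = "graph_step Z"
  have "bidiag q i = (\<Sum>j<m. bidiag (\<lambda>i. Z i j) i * q j)"
    using q i unfolding on_graph_def bidiag_def
    by (auto simp: sum_distrib_left sum.distrib algebra_simps)
  also have "\<dots> = (\<Sum>j<m. (l j * ?Y i j + (if j = 0 then 0 else c j * ?Y i (j - 1))) * q j)"
    by (intro sum.cong) (auto simp: graph_step_mult)
  also have "\<dots> = (\<Sum>j<m. l j * ?Y i j * q j) + (\<Sum>j<m. (if j = 0 then 0 else c j * ?Y i (j - 1) * q j))"
    by (simp add: sum.distrib algebra_simps if_distrib[of "\<lambda>x. x * _"] if_distrib[of "(*) _"] cong: if_cong)
  \<comment> \<open>After the index shift, the extra last term on the right has the factor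
    \<open>c m\<close>, which is zero.\<close>
  also have "(\<Sum>j<m. (if j = 0 then 0 else c j * ?Y i (j - 1) * q j))
      = (\<Sum>j<m. c (Suc j) * ?Y i j * q (Suc j))"
  proof -
    obtain p where p: "m = Suc p" using m_pos by (cases m) auto
    have "(\<Sum>j<m. (if j = 0 then 0 else c j * ?Y i (j - 1) * q j)) = (\<Sum>j<p. c (Suc j) * ?Y i j * q (Suc j))"
      unfolding p by (simp add: sum.lessThan_Suc_shift del: sum.lessThan_Suc)
    then show ?thesis using c_m unfolding p by simp
  qed
  also have "(\<Sum>j<m. l j * ?Y i j * q j) + (\<Sum>j<m. c (Suc j) * ?Y i j * q (Suc j)) = (\<Sum>j<m. ?Y i j * bidiag q j)"
    unfolding sum.distrib[symmetric] using m_less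
    by (intro sum.cong) (auto simp: bidiag_def algebra_simps)
  finally show "bidiag q i = (\<Sum>j<m. ?Y i j * bidiag q j)" .
qed

lemma graph_step_zero: "graph_step (\<lambda>_ _. 0) = (\<lambda>_ _. 0)"
proof (intro ext)
  show "graph_step (\<lambda>_ _. 0) i j = 0" for i j
    by (induction j) (auto simp: bidiag_def)
qed

text \<open>The leading block has nonzero diagonal and is decoupled from the rest by
  \<open>c m = 0\<close>, so back substitution from \<open>m - 1\<close> downwards clears the
  leading coordinates; the graph then clears the others. Thus even a singular \<open>A\<close> is
  injective on a graph.\<close>

lemma on_graph_kernel:
  assumes q: "on_graph Z q" and z: "\<And>i. i < n \<Longrightarrow> bidiag q i = 0" and i: "i < n"
  shows "q i = 0"
proof -
  have top: "q j = 0" if "j < m" for j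
    using that
  proof (induction "m - j" arbitrary: j rule: less_induct)
    case less
    have "c (Suc j) * q (Suc j) = 0"
    proof (cases "Suc j = m")
      case False
      then show ?thesis using less by simp
    qed (simp add: c_m)
    moreover have "bidiag q j = 0" using z less.prems m_less by simp
    ultimately show ?case using l_nonzero[OF less.prems] unfolding bidiag_def by (auto split: if_splits)
  qed
  then show ?thesis using q i unfolding on_graph_def by (cases "i < m") auto
qed

text \<open>The entry at \<open>(i, j)\<close> is driven only by those at \<open>(Suc i, j)\<close>
  and \<open>(i, j - 1)\<close>, both of smaller measure \<open>j + (n - i)\<close>, and its own
  factor \<open>l i / l j\<close> has modulus below one.\<close>

lemma graph_steps_tendsto_0:
  assumes Z: "\<And>k. Z (Suc k) = graph_step (Z k)"
  shows "m \<le> i \<Longrightarrow> i < n \<Longrightarrow> j < m \<Longrightarrow> (\<lambda>k. Z k i j) \<longlonglongrightarrow> 0"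
proof (induction "j + (n - i)" arbitrary: i j rule: less_induct)
  case less
  \<comment> \<open>Forward substitution uses the left neighbour already updated, hence
    \<open>Z (Suc k)\<close> in the second term.\<close>
  define b where "b = (\<lambda>k. ((if Suc i < n then c (Suc i) * Z k (Suc i) j else 0)
    - (if j = 0 then 0 else c j * Z (Suc k) i (j - 1))) / l j)"
  note lj = l_nonzero[OF less.prems(3)]
  have "Z (Suc k) i j = l i / l j * Z k i j + b k" for k
    using graph_step_mult[OF less.prems(3), of "Z k" i] lj
    unfolding b_def Z[symmetric] bidiag_def by (simp add: field_simps)
  moreover have "cmod (l i / l j) < 1" using gap[OF less.prems(3,1,2)] lj by (simp add: norm_divide)
  moreover have "b \<longlonglongrightarrow> 0"
  proof -
    have 1: "(\<lambda>k. if Suc i < n then c (Suc i) * Z k (Suc i) j else 0) \<longlonglongrightarrow> 0"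
      using less.hyps[of j "Suc i"] less.prems by (cases "Suc i < n") (auto intro: tendsto_mult_right_zero)
    have 2: "(\<lambda>k. if j = 0 then 0 else c j * Z (Suc k) i (j - 1)) \<longlonglongrightarrow> 0"
    proof (cases "j = 0")
      case False
      then have "(\<lambda>k. Z k i (j - 1)) \<longlonglongrightarrow> 0" using less.hyps[of "j - 1" i] less.prems by auto
      then show ?thesis using False tendsto_mult_right_zero[OF LIMSEQ_Suc] by simp
    qed simp
    show ?thesis unfolding b_def using tendsto_divide[OF tendsto_diff[OF 1 2] tendsto_const lj] by simp
  qed
  ultimately show ?case by (rule contracting_recurrence_tendsto_0)
qed

text \<open>The hypothesis says that \<open>G\<close> intertwines the bidiagonal matrix with its
  conjugate. On the lower left block this is a homogeneous Sylvester equation whose two spectra are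
  separated in modulus; the same induction order solves it.\<close>

lemma conj_intertwiner_lower_left_0:
  assumes G: "\<And>i j. i < n \<Longrightarrow> j < n \<Longrightarrow>
    bidiag (\<lambda>i. G i j) i = cnj (l j) * G i j + (if j = 0 then 0 else cnj (c j) * G i (j - 1))"
  shows "m \<le> i \<Longrightarrow> i < n \<Longrightarrow> j < m \<Longrightarrow> G i j = 0"
proof (induction "j + (n - i)" arbitrary: i j rule: less_induct)
  case less
  have "(if Suc i < n then c (Suc i) * G (Suc i) j else 0) = 0" using less by auto
  moreover have "(if j = 0 then 0 else cnj (c j) * G i (j - 1)) = 0" using less by auto
  ultimately have "(l i - cnj (l j)) * G i j = 0"
    using G[of i j] less.prems m_less unfolding bidiag_def by (simp add: algebra_simps)
  moreover have "l i \<noteq> cnj (l j)" using gap[OF less.prems(3,1,2)] by auto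
  ultimately show ?case by simp
qed

end

section \<open>Bidiagonal matrices and entrywise product formulas\<close>

text \<open>The superdiagonal is indexed by column, so that \<open>c j\<close> is the coefficient of
  the predecessor in the chain relation for column \<open>j\<close>.\<close>

definition bidiag_mat :: "nat \<Rightarrow> (nat \<Rightarrow> 'a) \<Rightarrow> (nat \<Rightarrow> 'a) \<Rightarrow> 'a :: comm_ring_1 mat" where
  "bidiag_mat n l c = mat n n (\<lambda>(i, j). if i = j then l j else if Suc i = j then c j else 0)"

lemma bidiag_mat_carrier [simp]: "bidiag_mat n l c \<in> carrier_mat n n"
  unfolding bidiag_mat_def by simp

lemma mult_bidiag_mat:
  assumes X: "X \<in> carrier_mat p n" and i: "i < p" and j: "j < n"
  shows "(X * bidiag_mat n l c) $$ (i, j) = l j * X $$ (i, j) + (if j = 0 then 0 else c j * X $$ (i, j - 1))"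
proof -
  have "(X * bidiag_mat n l c) $$ (i, j) = (\<Sum>k\<in>{0..<n}. X $$ (i, k) * (if k = j then l j else if Suc k = j then c j else 0))"
    using X i j by (simp add: bidiag_mat_def scalar_prod_def)
  \<comment> \<open>For \<open>j = 0\<close> the truncated \<open>j - 1\<close> is again 0; the
    inner conditional removes that spurious term.\<close>
  also have "\<dots> = (\<Sum>k\<in>{0..<n}. (if k = j then l j * X $$ (i, j) else 0)
      + (if k = j - 1 then (if j = 0 then 0 else c j * X $$ (i, j - 1)) else 0))"
    by (intro sum.cong) (auto simp: mult.commute)
  also have "\<dots> = l j * X $$ (i, j) + (if j = 0 then 0 else c j * X $$ (i, j - 1))"
    unfolding sum.distrib using j by simp
  finally show ?thesis .
qed

lemma bidiag_mat_mult_vec: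
  assumes q: "q \<in> carrier_vec n" and i: "i < n"
  shows "(bidiag_mat n l c *\<^sub>v q) $ i = l i * q $ i + (if Suc i < n then c (Suc i) * q $ Suc i else 0)"
proof -
  have "(bidiag_mat n l c *\<^sub>v q) $ i = (\<Sum>k\<in>{0..<n}. (if i = k then l k else if Suc i = k then c k else 0) * q $ k)"
    using q i by (simp add: bidiag_mat_def scalar_prod_def)
  also have "\<dots> = (\<Sum>k\<in>{0..<n}. (if k = i then l i * q $ i else 0)
      + (if k = Suc i then c (Suc i) * q $ Suc i else 0))"
    by (intro sum.cong) auto
  also have "\<dots> = l i * q $ i + (if Suc i < n then c (Suc i) * q $ Suc i else 0)"
    unfolding sum.distrib using i by simp
  finally show ?thesis .
qed

lemma conjugate_mult_mat_vec:
  fixes M :: "complex mat"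
  assumes "M \<in> carrier_mat p q" and "v \<in> carrier_vec q"
  shows "conjugate (M *\<^sub>v v) = map_mat cnj M *\<^sub>v conjugate v"
  by (rule eq_vecI) (use assms in \<open>auto simp: scalar_prod_def\<close>)

lemma smult_mat_mult_vec:
  fixes M :: "'a :: comm_semiring_0 mat"
  assumes "M \<in> carrier_mat p q" and "v \<in> carrier_vec q"
  shows "(a \<cdot>\<^sub>m M) *\<^sub>v v = a \<cdot>\<^sub>v (M *\<^sub>v v)"
  by (rule eq_vecI) (use assms in auto)

lemma mult_mat_entry:
  assumes "M \<in> carrier_mat p q" and "N \<in> carrier_mat q s" and "i < p" and "j < s"
  shows "(M * N) $$ (i, j) = (\<Sum>k<q. M $$ (i, k) * N $$ (k, j))"
  using assms by (simp add: scalar_prod_def lessThan_atLeast0)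

lemma mult_mat_zero_vec: "M \<in> carrier_mat p q \<Longrightarrow> M *\<^sub>v 0\<^sub>v q = 0\<^sub>v p"
  by (rule eq_vecI) auto

lemma mult_mat_unit_vec:
  fixes M :: "'a :: semiring_1 mat"
  shows "M \<in> carrier_mat p q \<Longrightarrow> j < q \<Longrightarrow> M *\<^sub>v unit_vec q j = col M j"
  by (rule eq_vecI) auto

lemma mult_mat_vec_entry:
  assumes "M \<in> carrier_mat p q" and "x \<in> carrier_vec q" and "i < p"
  shows "(M *\<^sub>v x) $ i = (\<Sum>j<q. M $$ (i, j) * x $ j)"
  using assms by (simp add: scalar_prod_def lessThan_atLeast0)

section \<open>The natural power method in Jordan coordinates\<close>

lemma stiefelD:
  assumes "X \<in> stiefel r n"
  shows "X \<in> carrier_mat n r" and "X\<^sup>T * X = 1\<^sub>m r"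
  using assms unfolding stiefel_def by auto

lemma stiefel_col_sum:
  assumes X: "X \<in> stiefel r n" and a: "a < r" and b: "b < r"
  shows "(\<Sum>i<n. X $$ (i, a) * X $$ (i, b)) = 1\<^sub>m r $$ (a, b)"
proof -
  have "(X\<^sup>T * X) $$ (a, b) = (\<Sum>i<n. X $$ (i, a) * X $$ (i, b))"
    using stiefelD(1)[OF X] a b by (simp add: scalar_prod_def lessThan_atLeast0)
  then show ?thesis using stiefelD(2)[OF X] by simp
qed

lemma stiefel_entry_le_1:
  assumes X: "X \<in> stiefel r n" and i: "i < n" and a: "a < r"
  shows "\<bar>X $$ (i, a)\<bar> \<le> 1"
proof -
  have "(X $$ (i, a))\<^sup>2 \<le> (\<Sum>i<n. (X $$ (i, a))\<^sup>2)"
    using member_le_sum[of i "{..<n}" "\<lambda>i. (X $$ (i, a))\<^sup>2"] i by simp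
  also have "\<dots> = 1" using stiefel_col_sum[OF X a a] a by (simp add: power2_eq_square)
  finally show ?thesis by (simp add: abs_square_le_1)
qed

text \<open>The transpose is a left inverse, also after embedding into the complex matrices.\<close>

lemma stiefel_mult_vec_0:
  assumes X: "X \<in> stiefel r n" and v: "v \<in> carrier_vec r"
    and z: "map_mat complex_of_real X *\<^sub>v v = 0\<^sub>v n"
  shows "v = 0\<^sub>v r"
proof -
  let ?X = "map_mat complex_of_real X"
  have Xc: "?X \<in> carrier_mat n r" using stiefelD(1)[OF X] by simp
  have "?X\<^sup>T * ?X = map_mat complex_of_real (X\<^sup>T * X)"
    using stiefelD(1)[OF X] by (simp add: of_real_hom.mat_hom_mult[of _ r n _ r] map_mat_transpose)
  also have "\<dots> = 1\<^sub>m r" unfolding stiefelD(2)[OF X] by (simp add: of_real_hom.mat_hom_one)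
  finally have "v = (?X\<^sup>T * ?X) *\<^sub>v v" using v by simp
  also have "\<dots> = ?X\<^sup>T *\<^sub>v (?X *\<^sub>v v)" using Xc v by (simp add: assoc_mult_mat_vec[of _ r n _ r])
  also have "\<dots> = 0\<^sub>v r" unfolding z using mult_mat_zero_vec[of "?X\<^sup>T" r n] Xc by simp
  finally show ?thesis .
qed

section \<open>Coordinates for a real matrix and complex conjugation\<close>

text \<open>\<open>Q\<close> reads off coordinates with respect to the columns of \<open>P\<close>,
  in which \<open>A\<close> acts as \<open>bidiag\<close>.\<close>

locale real_bidiagonal_form = bidiagonal_gap +
  fixes A :: "real mat" and P Q :: "complex mat"
  assumes A: "A \<in> carrier_mat n n" and P: "P \<in> carrier_mat n n" and Q: "Q \<in> carrier_mat n n"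
    and QP: "Q * P = 1\<^sub>m n" and PQ: "P * Q = 1\<^sub>m n"
    and AP: "map_mat complex_of_real A * P = P * bidiag_mat n l c"
begin

abbreviation A\<^sub>c :: "complex mat" where "A\<^sub>c \<equiv> map_mat complex_of_real A"

lemma Ac: "A\<^sub>c \<in> carrier_mat n n"
  using A by simp

lemma PQ_vec: "x \<in> carrier_vec n \<Longrightarrow> P *\<^sub>v (Q *\<^sub>v x) = x"
  using P Q PQ by (simp flip: assoc_mult_mat_vec[of _ n n _ n])

lemma QP_vec: "x \<in> carrier_vec n \<Longrightarrow> Q *\<^sub>v (P *\<^sub>v x) = x"
  using P Q QP by (simp flip: assoc_mult_mat_vec[of _ n n _ n])

lemma QA: "Q * A\<^sub>c = bidiag_mat n l c * Q"
proof -
  have "Q * A\<^sub>c = Q * A\<^sub>c * (P * Q)" unfolding PQ using Q Ac by simp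
  also have "\<dots> = Q * (A\<^sub>c * P) * Q" using Q Ac P by (simp add: assoc_mult_mat[of _ n n _ n _ n] mult_carrier_mat[of _ n n _ n])
  also have "\<dots> = (Q * P) * bidiag_mat n l c * Q" unfolding AP using Q Ac P by (simp add: assoc_mult_mat[of _ n n _ n _ n] mult_carrier_mat[of _ n n _ n])
  finally show ?thesis unfolding QP using left_mult_one_mat[OF bidiag_mat_carrier[of n l c]] by simp
qed

lemma coordinates_mult:
  assumes x: "x \<in> carrier_vec n" and i: "i < n"
  shows "(Q *\<^sub>v (A\<^sub>c *\<^sub>v x)) $ i = bidiag (\<lambda>i. (Q *\<^sub>v x) $ i) i"
proof -
  have "Q *\<^sub>v (A\<^sub>c *\<^sub>v x) = bidiag_mat n l c *\<^sub>v (Q *\<^sub>v x)"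
    using QA Q Ac x by (simp flip: assoc_mult_mat_vec[of _ n n _ n])
  then show ?thesis using bidiag_mat_mult_vec[of "Q *\<^sub>v x" n i l c] Q x i
    by (simp add: bidiag_def del: index_mult_mat_vec)
qed

lemma on_graph_cong: "(\<And>j. j < n \<Longrightarrow> q j = q' j) \<Longrightarrow> on_graph Z q = on_graph Z q'"
  unfolding on_graph_def using m_less by simp

text \<open>Conjugating \<open>AP\<close> leaves the real matrix \<open>A\<close> fixed, so
  \<open>Q * map_mat cnj P\<close> intertwines the bidiagonal matrix with its conjugate. In effect,
  the conjugates of the first \<open>m\<close> columns of \<open>P\<close> stay in their
  span.\<close>

lemma conj_lower_left_0:
  assumes "m \<le> i" and "i < n" and "j < m"
  shows "(Q * map_mat cnj P) $$ (i, j) = 0"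
proof -
  let ?P = "map_mat cnj P" and ?J = "bidiag_mat n l c"
    and ?J' = "bidiag_mat n (\<lambda>i. cnj (l i)) (\<lambda>i. cnj (c i))"
  have Pc: "?P \<in> carrier_mat n n" using P by simp
  define G where "G = Q * ?P"
  have G: "G \<in> carrier_mat n n" unfolding G_def using Q Pc by simp
  have J': "map_mat cnj ?J = ?J'" by (rule eq_matI) (auto simp: bidiag_mat_def)
  have cnj_mult: "map_mat cnj (M * N) = map_mat cnj M * map_mat cnj N"
    if "M \<in> carrier_mat n n" "N \<in> carrier_mat n n" for M N
    by (rule eq_matI) (use that in \<open>auto simp: scalar_prod_def\<close>)
  have "map_mat cnj A\<^sub>c = A\<^sub>c" by (rule eq_matI) auto
  then have AP': "A\<^sub>c * ?P = ?P * ?J'"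
    using arg_cong[OF AP, of "map_mat cnj"] cnj_mult[OF Ac P] cnj_mult[OF P bidiag_mat_carrier] J' by simp
  have "?J * G = Q * (A\<^sub>c * ?P)" unfolding G_def using QA Q Ac Pc
    by (simp flip: assoc_mult_mat[of _ n n _ n _ n])
  also have "\<dots> = G * ?J'" unfolding AP' G_def using Q Pc by (simp add: assoc_mult_mat[of _ n n _ n _ n])
  finally have JG: "?J * G = G * ?J'" .
  have "G $$ (i, j) = 0"
  proof (rule conj_intertwiner_lower_left_0[of "\<lambda>i j. G $$ (i, j)", OF _ assms])
    fix i j assume ij: "i < n" "j < n"
    have "bidiag (\<lambda>i. G $$ (i, j)) i = (?J *\<^sub>v col G j) $ i"
      using bidiag_mat_mult_vec[of "col G j" n i l c] G ij unfolding bidiag_def by simp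
    also have "\<dots> = (?J * G) $$ (i, j)" using G ij by (simp add: bidiag_mat_def)
    finally show "bidiag (\<lambda>i. G $$ (i, j)) i
      = cnj (l j) * G $$ (i, j) + (if j = 0 then 0 else cnj (c j) * G $$ (i, j - 1))"
      unfolding JG using mult_bidiag_mat[OF G ij] by simp
  qed
  then show ?thesis unfolding G_def .
qed

abbreviation dominant :: "complex vec \<Rightarrow> bool" where
  "dominant x \<equiv> on_graph (\<lambda>_ _. 0) (\<lambda>i. (Q *\<^sub>v x) $ i)"

text \<open>The coordinates of the conjugate vector are \<open>Q * map_mat cnj P\<close> applied to
  the conjugated coordinates; the zero lower left block of that matrix keeps the trailing ones
  zero.\<close>

lemma dominant_conjugate:
  assumes x: "x \<in> carrier_vec n" and d: "dominant x"
  shows "dominant (conjugate x)"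
proof -
  let ?P = "map_mat cnj P"
  have Pc: "?P \<in> carrier_mat n n" using P by simp
  have Qx: "Q *\<^sub>v x \<in> carrier_vec n" using Q x by simp
  have "conjugate x = ?P *\<^sub>v conjugate (Q *\<^sub>v x)"
    using conjugate_mult_mat_vec[OF P Qx] PQ_vec[OF x] by simp
  then have "Q *\<^sub>v conjugate x = (Q * ?P) *\<^sub>v conjugate (Q *\<^sub>v x)"
    using Q Pc Qx by (simp add: assoc_mult_mat_vec[of _ n n _ n])
  moreover have "((Q * ?P) *\<^sub>v conjugate (Q *\<^sub>v x)) $ i = 0" if i: "m \<le> i" "i < n" for i
  proof -
    have "((Q * ?P) *\<^sub>v conjugate (Q *\<^sub>v x)) $ i
        = (\<Sum>j<n. (Q * ?P) $$ (i, j) * conjugate (Q *\<^sub>v x) $ j)"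
      by (rule mult_mat_vec_entry[OF _ _ i(2)]) (use Qx Q Pc in auto)
    also have "\<dots> = 0"
    proof (rule sum.neutral, intro ballI)
      fix j assume j: "j \<in> {..<n}"
      show "(Q * ?P) $$ (i, j) * conjugate (Q *\<^sub>v x) $ j = 0"
      proof (cases "j < m")
        case True
        then show ?thesis using conj_lower_left_0[OF i True] by simp
      next
        case False
        then have "(Q *\<^sub>v x) $ j = 0" using d j unfolding on_graph_def by simp
        then have "conjugate (Q *\<^sub>v x) $ j = 0" using j Qx by (metis carrier_vecD conjugate_zero lessThan_iff vec_index_conjugate)
        then show ?thesis by simp
      qed
    qed
    finally show ?thesis .
  qed
  ultimately show ?thesis unfolding on_graph_def by simp
qed

section \<open>Column spaces inside a graph\<close>

text \<open>Constraining the whole complex column space makes the condition stable under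
  multiplication from the right, hence blind to the normalizing factor of the iteration.\<close>

definition mat_on_graph :: "nat \<Rightarrow> (nat \<Rightarrow> nat \<Rightarrow> complex) \<Rightarrow> real mat \<Rightarrow> bool" where
  "mat_on_graph r Z X \<longleftrightarrow>
     (\<forall>w \<in> carrier_vec r. on_graph Z (\<lambda>i. (Q *\<^sub>v (map_mat complex_of_real X *\<^sub>v w)) $ i))"

lemma mat_on_graph_mult:
  assumes X: "X \<in> carrier_mat n r" and R: "R \<in> carrier_mat r r" and g: "mat_on_graph r Z X"
  shows "mat_on_graph r Z (X * R)"
  unfolding mat_on_graph_def
proof
  fix w :: "complex vec" assume w: "w \<in> carrier_vec r"
  let ?w = "map_mat complex_of_real R *\<^sub>v w"
  have "map_mat complex_of_real (X * R) *\<^sub>v w = map_mat complex_of_real X *\<^sub>v ?w"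
    using X R w by (simp add: of_real_hom.mat_hom_mult[OF X R] assoc_mult_mat_vec[of _ n r _ r])
  moreover have "?w \<in> carrier_vec r" using R w by simp
  ultimately show "on_graph Z (\<lambda>i. (Q *\<^sub>v (map_mat complex_of_real (X * R) *\<^sub>v w)) $ i)"
    using g unfolding mat_on_graph_def by simp
qed

lemma mat_on_graph_power_step:
  assumes X: "X \<in> carrier_mat n r" and g: "mat_on_graph r Z X"
  shows "mat_on_graph r (graph_step Z) (A * X)"
  unfolding mat_on_graph_def
proof
  fix w :: "complex vec" assume w: "w \<in> carrier_vec r"
  let ?x = "map_mat complex_of_real X *\<^sub>v w"
  have x: "?x \<in> carrier_vec n" using X w by simp
  have eq: "map_mat complex_of_real (A * X) *\<^sub>v w = A\<^sub>c *\<^sub>v ?x"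
    using X A w by (simp add: of_real_hom.mat_hom_mult[OF A X] assoc_mult_mat_vec[of _ n n _ r])
  have "on_graph (graph_step Z) (bidiag (\<lambda>i. (Q *\<^sub>v ?x) $ i))"
    using g w unfolding mat_on_graph_def by (intro on_graph_step) simp
  then show "on_graph (graph_step Z) (\<lambda>i. (Q *\<^sub>v (map_mat complex_of_real (A * X) *\<^sub>v w)) $ i)"
    unfolding eq by (rule on_graph_cong[THEN iffD1, rotated]) (simp add: coordinates_mult[OF x] del: index_mult_mat_vec)
qed

text \<open>Injectivity of \<open>A\<close> on the graph gives \<open>A * X\<close> full column
  rank, so the inverse square root is a genuine one and \<open>X'\<close> is the orthogonal polar
  factor of \<open>A * X\<close>.\<close>

lemma natural_power_step:
  assumes X: "X \<in> stiefel r n" and g: "mat_on_graph r Z X"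
  defines "X' \<equiv> A * X * mat_inv_sqrt (X\<^sup>T * A\<^sup>T * A * X)"
  shows "X' \<in> stiefel r n" and "mat_on_graph r (graph_step Z) X'"
proof -
  note Xc = stiefelD(1)[OF X]
  have AX: "A * X \<in> carrier_mat n r" using A Xc by simp
  have gram: "X\<^sup>T * A\<^sup>T * A * X = (A * X)\<^sup>T * (A * X)"
    using A Xc by (simp add: transpose_mult[OF A Xc] assoc_mult_mat[of _ r n _ n _ r] mult_carrier_mat[of _ r n _ n])
  have det: "det ((A * X)\<^sup>T * (A * X)) \<noteq> 0"
  proof
    assume "det ((A * X)\<^sup>T * (A * X)) = 0"
    then obtain v where v: "v \<in> carrier_vec r" "v \<noteq> 0\<^sub>v r" "((A * X)\<^sup>T * (A * X)) *\<^sub>v v = 0\<^sub>v r"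
      using det_0_iff_vec_prod_zero_field[of "(A * X)\<^sup>T * (A * X)" r] AX by auto
    have AXv: "A * X *\<^sub>v v \<in> carrier_vec n" using AX v by simp
    have "(A * X *\<^sub>v v) \<bullet> (A * X *\<^sub>v v) = ((A * X)\<^sup>T *\<^sub>v (A * X *\<^sub>v v)) \<bullet> v"
      using transpose_vec_mult_scalar[OF AX v(1) AXv] by simp
    also have "(A * X)\<^sup>T *\<^sub>v (A * X *\<^sub>v v) = 0\<^sub>v r"
      using assoc_mult_mat_vec[of "(A * X)\<^sup>T" r n "A * X" r v] AX v by simp
    finally have "A * X *\<^sub>v v = 0\<^sub>v n" using conjugate_square_eq_0_vec[OF AXv] v by simp
    then have "A *\<^sub>v (X *\<^sub>v v) = 0\<^sub>v n" using A Xc v by (simp add: assoc_mult_mat_vec[of _ n n _ r])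
    then have "map_vec complex_of_real (A *\<^sub>v (X *\<^sub>v v)) = 0\<^sub>v n" by auto
    \<comment> \<open>The real kernel vector is embedded because the coordinates given by
      \<open>Q\<close> are complex.\<close>
    moreover define w where "w = map_vec complex_of_real v"
    moreover define x where "x = map_mat complex_of_real X *\<^sub>v w"
    ultimately have Ax: "A\<^sub>c *\<^sub>v x = 0\<^sub>v n"
      using A Xc v by (simp add: of_real_hom.mult_mat_vec_hom[of _ n n] of_real_hom.mult_mat_vec_hom[of _ n r])
    have w: "w \<in> carrier_vec r" and x: "x \<in> carrier_vec n" unfolding x_def w_def using Xc v by auto
    have "(Q *\<^sub>v x) $ i = 0" if i: "i < n" for i
    proof (rule on_graph_kernel[of Z "\<lambda>i. (Q *\<^sub>v x) $ i", OF _ _ i])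
      show "on_graph Z (\<lambda>i. (Q *\<^sub>v x) $ i)" using g w unfolding mat_on_graph_def x_def by simp
      show "bidiag (\<lambda>i. (Q *\<^sub>v x) $ i) i = 0" if "i < n" for i
        using coordinates_mult[OF x that] Q that unfolding Ax by simp
    qed
    then have "Q *\<^sub>v x = 0\<^sub>v n" using Q by (intro eq_vecI) auto
    then have "x = 0\<^sub>v n" using PQ_vec[OF x] mult_mat_zero_vec[OF P] by simp
    then have "w = 0\<^sub>v r" using stiefel_mult_vec_0[OF X w] unfolding x_def by simp
    then have "v $ i = 0" if "i < r" for i
      using that v(1) unfolding w_def by (metis carrier_vecD index_map_vec(1) index_zero_vec(1) of_real_eq_0_iff)
    then have "v = 0\<^sub>v r" using v(1) by (intro eq_vecI) auto
    then show False using v by simp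
  qed
  obtain S where "X' \<in> stiefel r n" and R: "mat_inv_sqrt ((A * X)\<^sup>T * (A * X)) \<in> carrier_mat r r"
    using polar_decomposition[OF AX det] unfolding X'_def gram by blast
  then show "X' \<in> stiefel r n" by simp
  show "mat_on_graph r (graph_step Z) X'" unfolding X'_def gram
    by (rule mat_on_graph_mult[OF AX R mat_on_graph_power_step[OF Xc g]])
qed

text \<open>A left inverse \<open>L\<close> of \<open>K\<close> recovers \<open>w\<close> from the
  leading coordinates \<open>K *\<^sub>v w\<close>, so the trailing ones are \<open>K' * L\<close>
  applied to them.\<close>

lemma admissible_set_on_graph:
  assumes X: "X \<in> admissible_set P n m r"
  shows "\<exists>Z. mat_on_graph r Z X"
proof -
  obtain K K' where K: "K \<in> carrier_mat m r" and K': "K' \<in> carrier_mat (n - m) r"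
    and rk: "vec_space.rank m K = r" and eq: "map_mat complex_of_real X = P * (K @\<^sub>r K')"
    using X unfolding admissible_set_def by blast
  obtain L where L: "L \<in> carrier_mat r m" and LK: "L * K = 1\<^sub>m r"
    using injective_mat_left_inverse[OF K] rank_eq_dim_col_iff[OF K] rk by blast
  \<comment> \<open>Rows of \<open>Z\<close> carry global coordinate numbers from \<open>m\<close>
    on, rows of \<open>K'\<close> start at 0.\<close>
  define Z where "Z = (\<lambda>i j. (K' * L) $$ (i - m, j))"
  have KK: "K @\<^sub>r K' \<in> carrier_mat n r" using carrier_append_rows[OF K K'] m_less by simp
  have "on_graph Z (\<lambda>i. (Q *\<^sub>v (map_mat complex_of_real X *\<^sub>v w)) $ i)" if w: "w \<in> carrier_vec r" for w
  proof -
    have "Q *\<^sub>v (map_mat complex_of_real X *\<^sub>v w) = (K @\<^sub>r K') *\<^sub>v w"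
      unfolding eq using P KK w QP_vec[of "(K @\<^sub>r K') *\<^sub>v w"] by (simp add: assoc_mult_mat_vec[of _ n n _ r])
    also have "\<dots> = (K *\<^sub>v w) @\<^sub>v (K' *\<^sub>v w)" by (rule mat_mult_append[OF K K' w])
    finally have q: "Q *\<^sub>v (map_mat complex_of_real X *\<^sub>v w) = (K *\<^sub>v w) @\<^sub>v (K' *\<^sub>v w)" .
    have "K' *\<^sub>v w = K' *\<^sub>v ((L * K) *\<^sub>v w)" unfolding LK using w by simp
    also have "\<dots> = (K' * L) *\<^sub>v (K *\<^sub>v w)" using K K' L w
      by (simp add: assoc_mult_mat_vec[of _ "n - m" r _ m] assoc_mult_mat_vec[of _ r m _ r])
    finally have K'w: "K' *\<^sub>v w = (K' * L) *\<^sub>v (K *\<^sub>v w)" .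
    show ?thesis unfolding on_graph_def q
    proof (intro allI impI)
      fix i assume i: "m \<le> i \<and> i < n"
      have "((K *\<^sub>v w) @\<^sub>v (K' *\<^sub>v w)) $ i = (K' *\<^sub>v w) $ (i - m)"
        using i K K' by (simp del: index_mult_mat_vec)
      also have "\<dots> = (\<Sum>j<m. (K' * L) $$ (i - m, j) * (K *\<^sub>v w) $ j)"
        unfolding K'w by (rule mult_mat_vec_entry) (use i K K' L w in auto)
      also have "\<dots> = (\<Sum>j<m. Z i j * ((K *\<^sub>v w) @\<^sub>v (K' *\<^sub>v w)) $ j)"
        unfolding Z_def using K K' by (intro sum.cong) (auto simp del: index_mult_mat index_mult_mat_vec)
      finally show "((K *\<^sub>v w) @\<^sub>v (K' *\<^sub>v w)) $ i = (\<Sum>j<m. Z i j * ((K *\<^sub>v w) @\<^sub>v (K' *\<^sub>v w)) $ j)" .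
    qed
  qed
  then show ?thesis unfolding mat_on_graph_def by blast
qed

text \<open>Testing on unit vectors shows that the trailing rows of \<open>Q\<close> times the
  embedded \<open>X\<close> vanish, and the leading rows form \<open>K\<close>. Its rank is
  \<open>r\<close> because a kernel vector of \<open>K\<close> would be one of \<open>X\<close>,
  which is injective.\<close>

lemma limit_set_iff:
  "X \<in> limit_set P n m r \<longleftrightarrow> X \<in> stiefel r n \<and> mat_on_graph r (\<lambda>_ _. 0) X"
proof
  assume L: "X \<in> limit_set P n m r"
  then obtain K where K: "K \<in> carrier_mat m r" and eq: "map_mat complex_of_real X = P * (K @\<^sub>r 0\<^sub>m (n - m) r)"
    unfolding limit_set_def by blast
  have Z: "0\<^sub>m (n - m) r \<in> carrier_mat (n - m) r" by simp
  have KK: "K @\<^sub>r 0\<^sub>m (n - m) r \<in> carrier_mat n r" using carrier_append_rows[OF K Z] m_less by simp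
  have "dominant (map_mat complex_of_real X *\<^sub>v w)" if w: "w \<in> carrier_vec r" for w
  proof -
    have "Q *\<^sub>v (map_mat complex_of_real X *\<^sub>v w) = (K @\<^sub>r 0\<^sub>m (n - m) r) *\<^sub>v w"
      unfolding eq using P KK w QP_vec[of "(K @\<^sub>r 0\<^sub>m (n - m) r) *\<^sub>v w"] by (simp add: assoc_mult_mat_vec[of _ n n _ r])
    also have "\<dots> = (K *\<^sub>v w) @\<^sub>v (0\<^sub>m (n - m) r *\<^sub>v w)" by (rule mat_mult_append[OF K Z w])
    finally show ?thesis unfolding on_graph_def using K w by auto
  qed
  then show "X \<in> stiefel r n \<and> mat_on_graph r (\<lambda>_ _. 0) X"
    using L unfolding limit_set_def mat_on_graph_def by blast
next
  assume R: "X \<in> stiefel r n \<and> mat_on_graph r (\<lambda>_ _. 0) X"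
  then have X: "X \<in> stiefel r n" by simp
  let ?X = "map_mat complex_of_real X"
  note Xc = stiefelD(1)[OF X]
  have Xc': "?X \<in> carrier_mat n r" using Xc by simp
  define M where "M = Q * ?X"
  have M: "M \<in> carrier_mat n r" unfolding M_def using Q Xc by simp
  define K where "K = mat m r (\<lambda>(i, j). M $$ (i, j))"
  have K: "K \<in> carrier_mat m r" unfolding K_def by simp
  have Z: "0\<^sub>m (n - m) r \<in> carrier_mat (n - m) r" by simp
  have zero: "M $$ (i, a) = 0" if "m \<le> i" "i < n" "a < r" for i a
  proof -
    have "M $$ (i, a) = (Q *\<^sub>v (?X *\<^sub>v unit_vec r a)) $ i"
      unfolding M_def using that Q Xc mult_mat_unit_vec[OF Xc' that(3)] by simp
    then show ?thesis using R that unfolding mat_on_graph_def on_graph_def by simp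
  qed
  have MK: "M = K @\<^sub>r 0\<^sub>m (n - m) r"
    by (rule eq_matI) (use K M zero m_less in \<open>auto simp: append_rows_def K_def\<close>)
  have "?X = P * M" unfolding M_def using P Q Xc' PQ by (simp flip: assoc_mult_mat[of _ n n _ n _ r])
  moreover have "vec_space.rank m K = r" unfolding rank_eq_dim_col_iff[OF K]
  proof (intro ballI impI)
    fix v assume v: "v \<in> carrier_vec r" and Kv: "K *\<^sub>v v = 0\<^sub>v m"
    have "M *\<^sub>v v = 0\<^sub>v m @\<^sub>v (0\<^sub>m (n - m) r *\<^sub>v v)" unfolding MK using mat_mult_append[OF K Z v] Kv by simp
    also have "\<dots> = 0\<^sub>v n" using v m_less by (intro eq_vecI) auto
    finally have "?X *\<^sub>v v = 0\<^sub>v n" unfolding \<open>?X = P * M\<close> using P M v mult_mat_zero_vec[OF P] by (simp add: assoc_mult_mat_vec[of _ n n _ r])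
    then show "v = 0\<^sub>v r" by (rule stiefel_mult_vec_0[OF X v])
  qed
  ultimately show "X \<in> limit_set P n m r" unfolding limit_set_def using X K MK by blast
qed

end

section \<open>Convergence to a set from entrywise estimates\<close>

lemma det_tendsto:
  fixes M :: "nat \<Rightarrow> real mat"
  assumes M: "\<And>k. M k \<in> carrier_mat r r" and L: "L \<in> carrier_mat r r"
    and lim: "\<And>i j. i < r \<Longrightarrow> j < r \<Longrightarrow> (\<lambda>k. M k $$ (i, j)) \<longlonglongrightarrow> L $$ (i, j)"
  shows "(\<lambda>k. det (M k)) \<longlonglongrightarrow> det L"
proof -
  have "(\<lambda>k. \<Sum>p\<in>{p. p permutes {0..<r}}. signof p * (\<Prod>i = 0..<r. M k $$ (i, p i)))
    \<longlonglongrightarrow> (\<Sum>p\<in>{p. p permutes {0..<r}}. signof p * (\<Prod>i = 0..<r. L $$ (i, p i)))"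
    by (intro tendsto_sum tendsto_mult_left tendsto_prod lim) (auto simp: permutes_in_image)
  then show ?thesis unfolding det_def'[OF M] det_def'[OF L] .
qed

text \<open>One nearby point of \<open>S\<close> bounds the infimum from above. Points are demanded
  only eventually, since polar factors are available only once the Gram matrix is
  non-singular.\<close>

lemma converges_to_setI:
  assumes U: "\<And>k. U k \<in> carrier_mat n r"
    and V: "\<forall>\<^sub>F k in sequentially. \<exists>V \<in> S. V \<in> carrier_mat n r \<and>
      (\<forall>i<n. \<forall>a<r. \<bar>U k $$ (i, a) - V $$ (i, a)\<bar> \<le> e k i a)"
    and e: "\<And>i a. i < n \<Longrightarrow> a < r \<Longrightarrow> (\<lambda>k. e k i a) \<longlonglongrightarrow> 0"
  shows "converges_to_set U S"
proof -
  define d where "d = (\<lambda>k. sqrt (\<Sum>i<n. \<Sum>a<r. (e k i a)\<^sup>2))"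
  have d: "d \<longlonglongrightarrow> 0"
  proof -
    have "(\<lambda>k. \<Sum>i<n. \<Sum>a<r. (e k i a)\<^sup>2) \<longlonglongrightarrow> (\<Sum>i<n. \<Sum>a<r. 0\<^sup>2)"
      by (intro tendsto_sum tendsto_power e) auto
    then show ?thesis unfolding d_def using tendsto_real_sqrt by fastforce
  qed
  have bdd: "bdd_below ((\<lambda>V. frob_norm (U k - V)) ` S)" for k
    by (rule bdd_belowI[of _ 0]) (auto simp: frob_norm_def sum_nonneg)
  \<comment> \<open>An eventual property holds at some index, and the point found there shows
    \<open>S\<close> inhabited.\<close>
  have ne: "S \<noteq> {}" using eventually_happens[OF V] by auto
  have low: "0 \<le> (INF V\<in>S. frob_norm (U k - V))" for k
    using ne by (intro cINF_greatest) (auto simp: frob_norm_def sum_nonneg)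
  have up: "\<forall>\<^sub>F k in sequentially. (INF V\<in>S. frob_norm (U k - V)) \<le> d k"
    using V
  proof eventually_elim
    case (elim k)
    then obtain V where V: "V \<in> S" "V \<in> carrier_mat n r"
      "\<And>i a. i < n \<Longrightarrow> a < r \<Longrightarrow> \<bar>U k $$ (i, a) - V $$ (i, a)\<bar> \<le> e k i a" by blast
    have "frob_norm (U k - V) = sqrt (\<Sum>i<n. \<Sum>a<r. (U k $$ (i, a) - V $$ (i, a))\<^sup>2)"
      unfolding frob_norm_def using U[of k] V(2) by simp
    also have "\<dots> \<le> d k" unfolding d_def
      by (intro real_sqrt_le_mono sum_mono) (use V(3) in \<open>auto intro!: power2_le_iff_abs_le[THEN iffD2] order_trans[OF abs_ge_zero]\<close>)
    finally show ?case using cINF_lower[OF bdd V(1), of k] by linarith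
  qed
  have "(\<lambda>k. INF V\<in>S. frob_norm (U k - V)) \<longlonglongrightarrow> 0"
    by (rule tendsto_sandwich[OF _ up tendsto_const d]) (simp add: low)
  then show ?thesis unfolding converges_to_set_def using ne by simp
qed

section \<open>Invariance of the limit set and convergence of the iterates\<close>

context real_bidiagonal_form
begin

lemma natural_power_solution_on_graph:
  assumes "natural_power_solution A U" and "U 0 \<in> stiefel r n" and "mat_on_graph r Z (U 0)"
  shows "U k \<in> stiefel r n \<and> mat_on_graph r ((graph_step ^^ k) Z) (U k)"
proof (induction k)
  case (Suc k)
  then show ?case
    using natural_power_step[of "U k" r "(graph_step ^^ k) Z"] assms(1)
    unfolding natural_power_solution_def by simp
qed (use assms in simp)

text \<open>The zero map is a fixed point of \<open>graph_step\<close>.\<close>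

lemma limit_set_invariant: "invariant_set A (limit_set P n m r)"
  unfolding invariant_set_def
proof (intro allI impI)
  fix U k assume U: "natural_power_solution A U \<and> U 0 \<in> limit_set P n m r"
  have "(graph_step ^^ k) (\<lambda>_ _. 0) = (\<lambda>_ _. 0)"
    by (induction k) (simp_all add: graph_step_zero)
  then show "U k \<in> limit_set P n m r"
    using natural_power_solution_on_graph[of U r "\<lambda>_ _. 0" k] U unfolding limit_set_iff by simp
qed

text \<open>A bound uniform over the Stiefel manifold: it lets graph maps tending to zero force the
  trailing coordinates to zero.\<close>

lemma coordinate_bound:
  assumes X: "X \<in> stiefel r n" and i: "i < n" and a: "a < r"
  shows "cmod ((Q * map_mat complex_of_real X) $$ (i, a)) \<le> (\<Sum>j<n. cmod (Q $$ (i, j)))"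
proof -
  have "(Q * map_mat complex_of_real X) $$ (i, a) = (\<Sum>j<n. Q $$ (i, j) * complex_of_real (X $$ (j, a)))"
    using stiefelD(1)[OF X] Q i a by (simp add: scalar_prod_def lessThan_atLeast0)
  also have "cmod \<dots> \<le> (\<Sum>j<n. cmod (Q $$ (i, j)))"
    using stiefel_entry_le_1[OF X _ a]
    by (intro sum_norm_le) (auto simp: norm_mult mult_left_le)
  finally show ?thesis .
qed

text \<open>Inside \<open>Re\<close> stands the projection onto the span of the first
  \<open>m\<close> columns of \<open>P\<close> along the span of the others. Taking
  \<open>Re\<close> makes the result real by construction.\<close>

definition real_projection :: "nat \<Rightarrow> real mat \<Rightarrow> real mat" where
  "real_projection r X = mat n r (\<lambda>(i, a).
     Re (\<Sum>j<m. P $$ (i, j) * (Q * map_mat complex_of_real X) $$ (j, a)))"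

text \<open>The real part is half the sum of the projection and its conjugate, and dominant vectors
  are closed under conjugation and linear combination.\<close>

lemma real_projection_dominant:
  assumes X: "X \<in> carrier_mat n r"
  shows "mat_on_graph r (\<lambda>_ _. 0) (real_projection r X)"
  unfolding mat_on_graph_def
proof
  fix w :: "complex vec" assume w: "w \<in> carrier_vec r"
  let ?X = "map_mat complex_of_real X"
  define T where "T = mat n r (\<lambda>(j, a). if j < m then (Q * ?X) $$ (j, a) else 0)"
  have T: "T \<in> carrier_mat n r" unfolding T_def by simp
  define M where "M = P * T"
  have M: "M \<in> carrier_mat n r" unfolding M_def using P T by simp
  have dom: "dominant (M *\<^sub>v u)" if u: "u \<in> carrier_vec r" for u
  proof -
    have "Q *\<^sub>v (M *\<^sub>v u) = T *\<^sub>v u" unfolding M_def using P T u QP_vec[of "T *\<^sub>v u"]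
      by (simp add: assoc_mult_mat_vec[of _ n n _ r])
    then show ?thesis unfolding on_graph_def using mult_mat_vec_entry[OF T u] by (simp add: T_def del: index_mult_mat_vec index_mult_mat)
  qed
  have Mw: "M *\<^sub>v w \<in> carrier_vec n" "M *\<^sub>v conjugate w \<in> carrier_vec n" using M w by auto
  have entry: "M $$ (i, a) = (\<Sum>j<m. P $$ (i, j) * (Q * ?X) $$ (j, a))" if "i < n" "a < r" for i a
  proof -
    have "M $$ (i, a) = (\<Sum>j<n. P $$ (i, j) * T $$ (j, a))"
      unfolding M_def using P T that by (simp add: scalar_prod_def lessThan_atLeast0)
    also have "\<dots> = (\<Sum>j<n. if j < m then P $$ (i, j) * (Q * ?X) $$ (j, a) else 0)"
      unfolding T_def using that by (intro sum.cong) (auto simp del: index_mult_mat)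
    also have "\<dots> = (\<Sum>j<m. P $$ (i, j) * (Q * ?X) $$ (j, a))"
      using m_less by (intro sum.mono_neutral_cong_right) auto
    finally show ?thesis .
  qed
  have Re: "complex_of_real (Re z) = 1/2 * (z + cnj z)" for z
    by (simp add: complex_add_cnj)
  have "map_mat complex_of_real (real_projection r X) = (1/2) \<cdot>\<^sub>m (M + map_mat cnj M)"
  proof (rule eq_matI)
    fix i a assume "i < dim_row ((1/2) \<cdot>\<^sub>m (M + map_mat cnj M))" "a < dim_col ((1/2) \<cdot>\<^sub>m (M + map_mat cnj M))"
    then have ia: "i < n" "a < r" using M by auto
    then have "map_mat complex_of_real (real_projection r X) $$ (i, a) = complex_of_real (Re (M $$ (i, a)))"
      unfolding real_projection_def entry[OF ia] by simp
    then show "map_mat complex_of_real (real_projection r X) $$ (i, a) = ((1/2) \<cdot>\<^sub>m (M + map_mat cnj M)) $$ (i, a)"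
      unfolding Re using M ia by simp
  qed (use M in \<open>auto simp: real_projection_def\<close>)
  then have "map_mat complex_of_real (real_projection r X) *\<^sub>v w
      = (1/2) \<cdot>\<^sub>v (M *\<^sub>v w + map_mat cnj M *\<^sub>v w)"
    using M w by (simp add: smult_mat_mult_vec[of _ n r] add_mult_distrib_mat_vec[of _ n r])
  \<comment> \<open>The test vector \<open>w\<close> is complex, so the conjugation must be shifted
    onto it as well.\<close>
  also have "map_mat cnj M *\<^sub>v w = conjugate (M *\<^sub>v conjugate w)"
    using conjugate_mult_mat_vec[OF M, of "conjugate w"] w by simp
  finally have "Q *\<^sub>v (map_mat complex_of_real (real_projection r X) *\<^sub>v w)
      = (1/2) \<cdot>\<^sub>v (Q *\<^sub>v (M *\<^sub>v w) + Q *\<^sub>v conjugate (M *\<^sub>v conjugate w))"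
    using Q Mw by (simp add: mult_mat_vec[of _ n n] mult_add_distrib_mat_vec[of _ n n])
  moreover have "dominant (M *\<^sub>v w)" "dominant (conjugate (M *\<^sub>v conjugate w))"
    using dom w dominant_conjugate[OF Mw(2)] by auto
  ultimately show "dominant (map_mat complex_of_real (real_projection r X) *\<^sub>v w)"
    using Q Mw unfolding on_graph_def by (simp del: index_mult_mat_vec)
qed

text \<open>The error is the real part of the contribution of the trailing coordinates, which are
  the vanishing graph map applied to bounded leading coordinates.\<close>

lemma real_projection_error_tendsto_0:
  assumes U: "\<And>k. U k \<in> stiefel r n" and g: "\<And>k. mat_on_graph r ((graph_step ^^ k) Z) (U k)"
    and i: "i < n" and a: "a < r"
  shows "(\<lambda>k. U k $$ (i, a) - real_projection r (U k) $$ (i, a)) \<longlonglongrightarrow> 0"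
proof -
  let ?q = "\<lambda>k. Q * map_mat complex_of_real (U k)"
  have Uc: "map_mat complex_of_real (U k) \<in> carrier_mat n r" for k using stiefelD(1)[OF U] by simp
  have q: "?q k \<in> carrier_mat n r" for k using Q Uc by simp
  have low: "(\<lambda>k. ?q k $$ (j, a)) \<longlonglongrightarrow> 0" if j: "m \<le> j" "j < n" for j
  proof -
    have eq: "?q k $$ (j, a) = (\<Sum>b<m. (graph_step ^^ k) Z j b * ?q k $$ (b, a))" for k
    proof -
      have "(Q *\<^sub>v (map_mat complex_of_real (U k) *\<^sub>v unit_vec r a)) $ b = ?q k $$ (b, a)" if "b < n" for b
        using mult_mat_unit_vec[OF Uc a] Q stiefelD(1)[OF U, of k] that a by simp
      then show ?thesis
        using g[of k, unfolded mat_on_graph_def, rule_format, of "unit_vec r a"] j m_less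
        unfolding on_graph_def by (simp del: index_mult_mat_vec index_mult_mat)
    qed
    have "(\<lambda>k. (graph_step ^^ k) Z j b * ?q k $$ (b, a)) \<longlonglongrightarrow> 0" if b: "b < m" for b
    proof (rule tendsto_0_le)
      show "(\<lambda>k. (graph_step ^^ k) Z j b) \<longlonglongrightarrow> 0"
        using graph_steps_tendsto_0[of "\<lambda>k. (graph_step ^^ k) Z", OF _ j b] by simp
      show "\<forall>\<^sub>F k in sequentially. norm ((graph_step ^^ k) Z j b * ?q k $$ (b, a))
          \<le> norm ((graph_step ^^ k) Z j b) * (\<Sum>s<n. cmod (Q $$ (b, s)))"
        unfolding norm_mult using coordinate_bound[OF U _ a] b m_less
        by (intro always_eventually allI mult_left_mono) auto
    qed
    then show ?thesis unfolding eq by (intro tendsto_null_sum) auto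
  qed
  \<comment> \<open>As \<open>U k\<close> is real, it is the real part of its full expansion; the
    projection cancels the first \<open>m\<close> terms.\<close>
  have "U k $$ (i, a) - real_projection r (U k) $$ (i, a)
      = Re (\<Sum>j\<in>{m..<n}. P $$ (i, j) * ?q k $$ (j, a))" for k
  proof -
    have "map_mat complex_of_real (U k) = P * ?q k" using P Q Uc[of k] PQ
      by (simp flip: assoc_mult_mat[of _ n n _ n _ r])
    then have "complex_of_real (U k $$ (i, a)) = (P * ?q k) $$ (i, a)"
      using stiefelD(1)[OF U, of k] i a by (metis carrier_matD index_map_mat(1))
    also have "\<dots> = (\<Sum>j<n. P $$ (i, j) * ?q k $$ (j, a))"
      using P q[of k] i a by (subst index_mult_mat) (auto simp: scalar_prod_def lessThan_atLeast0 simp del: index_mult_mat)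
    also have "{..<n} = {..<m} \<union> {m..<n}" using m_less by auto
    also have "(\<Sum>j\<in>{..<m} \<union> {m..<n}. P $$ (i, j) * ?q k $$ (j, a))
      = (\<Sum>j<m. P $$ (i, j) * ?q k $$ (j, a)) + (\<Sum>j\<in>{m..<n}. P $$ (i, j) * ?q k $$ (j, a))"
      by (rule sum.union_disjoint) auto
    finally have "U k $$ (i, a) = Re ((\<Sum>j<m. P $$ (i, j) * ?q k $$ (j, a)) + (\<Sum>j\<in>{m..<n}. P $$ (i, j) * ?q k $$ (j, a)))"
      by (metis Re_complex_of_real)
    then show ?thesis unfolding real_projection_def using i a by (simp del: index_mult_mat)
  qed
  moreover have "(\<lambda>k. Re (\<Sum>j\<in>{m..<n}. P $$ (i, j) * ?q k $$ (j, a))) \<longlonglongrightarrow> Re 0"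
    by (intro tendsto_Re tendsto_null_sum tendsto_mult_right_zero low) auto
  ultimately show ?thesis by simp
qed

text \<open>The projected iterates \<open>Y k\<close> approach \<open>U k\<close>, so their Gram
  matrices tend to the identity. Eventually the polar factor of \<open>Y k\<close> exists; it
  inherits the zero graph from \<open>Y k\<close> and differs from it by a multiple of
  \<open>S - 1\<^sub>m r\<close>.\<close>

lemma natural_power_converges:
  assumes U: "\<And>k. U k \<in> stiefel r n" and g: "\<And>k. mat_on_graph r ((graph_step ^^ k) Z) (U k)"
  shows "converges_to_set U (limit_set P n m r)"
proof -
  define Y where "Y = (\<lambda>k. real_projection r (U k))"
  define D where "D = (\<lambda>k i a. U k $$ (i, a) - Y k $$ (i, a))"
  define E where "E = (\<lambda>k a b. ((Y k)\<^sup>T * Y k) $$ (a, b) - 1\<^sub>m r $$ (a, b))"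
  have Y: "Y k \<in> carrier_mat n r" for k unfolding Y_def real_projection_def by simp
  have D0: "(\<lambda>k. D k i a) \<longlonglongrightarrow> 0" if "i < n" "a < r" for i a
    unfolding D_def Y_def by (rule real_projection_error_tendsto_0[OF U g that])
  have E0: "(\<lambda>k. E k a b) \<longlonglongrightarrow> 0" if a: "a < r" and b: "b < r" for a b
  proof -
    have UD: "(\<lambda>k. U k $$ (i, s) * D k i t) \<longlonglongrightarrow> 0" if "i < n" "s < r" "t < r" for i s t
    proof (rule tendsto_0_le[OF D0[OF that(1,3)]])
      show "\<forall>\<^sub>F k in sequentially. norm (U k $$ (i, s) * D k i t) \<le> norm (D k i t) * 1"
        using stiefel_entry_le_1[OF U that(1,2)]
        by (intro always_eventually allI) (simp add: abs_mult mult_left_le_one_le)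
    qed
    \<comment> \<open>Expand the Gram matrix of \<open>Y = U - D\<close> and cancel that of
      \<open>U\<close>, which is the identity.\<close>
    have "E k a b = (\<Sum>i<n. D k i a * D k i b - U k $$ (i, b) * D k i a - U k $$ (i, a) * D k i b)" for k
    proof -
      have "((Y k)\<^sup>T * Y k) $$ (a, b) = (\<Sum>i<n. Y k $$ (i, a) * Y k $$ (i, b))"
        using Y[of k] a b by (simp add: scalar_prod_def lessThan_atLeast0)
      then show ?thesis unfolding E_def D_def stiefel_col_sum[OF U a b, of k, symmetric]
        by (simp add: sum_subtractf[symmetric] algebra_simps)
    qed
    moreover have "(\<lambda>k. \<Sum>i<n. D k i a * D k i b - U k $$ (i, b) * D k i a - U k $$ (i, a) * D k i b)
      \<longlonglongrightarrow> (\<Sum>i<n. 0 * 0 - 0 - 0)"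
      by (intro tendsto_sum tendsto_diff tendsto_mult D0 UD) (use a b in auto)
    ultimately show ?thesis by simp
  qed
  \<comment> \<open>The first term bounds the distance from \<open>U k\<close> to
    \<open>Y k\<close>, the second that from \<open>Y k\<close> to its polar factor; the latter adds
    one copy of the same bound per column \<open>b\<close>.\<close>
  define e where "e = (\<lambda>k i a. \<bar>D k i a\<bar> + (\<Sum>b<r. sqrt (\<Sum>s<r. (E k s a)\<^sup>2)))"
  have e0: "(\<lambda>k. e k i a) \<longlonglongrightarrow> 0" if "i < n" "a < r" for i a
  proof -
    have "(\<lambda>k. e k i a) \<longlonglongrightarrow> \<bar>0\<bar> + (\<Sum>b<r. sqrt (\<Sum>s<r. 0\<^sup>2))"
      unfolding e_def by (intro tendsto_add tendsto_rabs tendsto_sum tendsto_real_sqrt tendsto_power D0 E0) (use that in auto)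
    then show ?thesis by simp
  qed
  have "(\<lambda>k. det ((Y k)\<^sup>T * Y k)) \<longlonglongrightarrow> det (1\<^sub>m r)"
  proof (rule det_tendsto)
    show "(Y k)\<^sup>T * Y k \<in> carrier_mat r r" for k using Y[of k] by simp
    show "(\<lambda>k. ((Y k)\<^sup>T * Y k) $$ (i, j)) \<longlonglongrightarrow> 1\<^sub>m r $$ (i, j)" if "i < r" "j < r" for i j
      using E0[OF that] unfolding E_def by (rule LIM_zero_cancel)
  qed simp
  then have "\<forall>\<^sub>F k in sequentially. det ((Y k)\<^sup>T * Y k) \<noteq> 0"
    by (rule tendsto_imp_eventually_ne) simp
  then have "\<forall>\<^sub>F k in sequentially. \<exists>V \<in> limit_set P n m r. V \<in> carrier_mat n r \<and>
      (\<forall>i<n. \<forall>a<r. \<bar>U k $$ (i, a) - V $$ (i, a)\<bar> \<le> e k i a)"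
  proof eventually_elim
    case (elim k)
    define V where "V = Y k * mat_inv_sqrt ((Y k)\<^sup>T * Y k)"
    obtain S where S: "psd_mat r S" "S * S = (Y k)\<^sup>T * Y k" and V: "V \<in> stiefel r n" and YV: "Y k = V * S"
      and R: "mat_inv_sqrt ((Y k)\<^sup>T * Y k) \<in> carrier_mat r r"
      unfolding V_def by (rule polar_decomposition[OF Y elim])
    have Sc: "S \<in> carrier_mat r r" using S(1) unfolding psd_mat_def by simp
    note Vc = stiefelD(1)[OF V]
    have "mat_on_graph r (\<lambda>_ _. 0) V" unfolding V_def
      by (rule mat_on_graph_mult[OF Y R]) (simp add: Y_def real_projection_dominant[OF stiefelD(1)[OF U]])
    then have "V \<in> limit_set P n m r" unfolding limit_set_iff using V by simp
    moreover have "\<bar>U k $$ (i, a) - V $$ (i, a)\<bar> \<le> e k i a" if i: "i < n" and a: "a < r" for i a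
    proof -
      have "Y k $$ (i, a) - V $$ (i, a) = (V * S) $$ (i, a) - (V * 1\<^sub>m r) $$ (i, a)"
        unfolding YV using Vc by simp
      also have "\<dots> = (\<Sum>b<r. V $$ (i, b) * (S $$ (b, a) - 1\<^sub>m r $$ (b, a)))"
        unfolding mult_mat_entry[OF Vc Sc i a] mult_mat_entry[OF Vc one_carrier_mat i a]
        by (simp only: sum_subtractf[symmetric] right_diff_distrib)
      also have "\<bar>\<dots>\<bar> \<le> (\<Sum>b<r. sqrt (\<Sum>s<r. (E k s a)\<^sup>2))"
      proof (rule order_trans[OF sum_abs], rule sum_mono)
        fix b assume "b \<in> {..<r}"
        then have b: "b < r" by simp
        have "\<bar>V $$ (i, b) * (S $$ (b, a) - 1\<^sub>m r $$ (b, a))\<bar> \<le> \<bar>S $$ (b, a) - 1\<^sub>m r $$ (b, a)\<bar>"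
          using stiefel_entry_le_1[OF V i b] by (simp add: abs_mult mult_left_le_one_le del: index_one_mat)
        also have "\<dots> \<le> sqrt (\<Sum>s<r. (E k s a)\<^sup>2)"
          using psd_sqrt_minus_one_bound[OF S(1) b a] unfolding E_def S(2) .
        finally show "\<bar>V $$ (i, b) * (S $$ (b, a) - 1\<^sub>m r $$ (b, a))\<bar> \<le> sqrt (\<Sum>s<r. (E k s a)\<^sup>2)" .
      qed
      finally show ?thesis unfolding e_def D_def by linarith
    qed
    ultimately show ?case using Vc by blast
  qed
  from converges_to_setI[OF stiefelD(1)[OF U] this e0] show ?thesis .
qed

end

section \<open>From Jordan chains to a bidiagonal form\<close>

text \<open>Each column of \<open>P\<close> is mapped into the span of itself and its predecessor. A
  link across position \<open>m\<close> would need equal eigenvalues at \<open>m - 1\<close> and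
  \<open>m\<close>, which the gap excludes; so \<open>c m = 0\<close>.\<close>

lemma jordan_eigenbasis_bidiagonal_form:
  assumes A: "A \<in> carrier_mat n n"
    and ev: "ordered_eigenvalues (map_mat complex_of_real A) l"
    and basis: "jordan_eigenbasis n (map_mat complex_of_real A) l P"
    and m: "0 < m" "m < n" and gap: "cmod (l ! (m - 1)) > cmod (l ! m)"
  shows "\<exists>c Q. real_bidiagonal_form n m (\<lambda>i. l ! i) c A P Q"
proof -
  let ?A = "map_mat complex_of_real A"
  have Ac: "?A \<in> carrier_mat n n" using A by simp
  have P: "P \<in> carrier_mat n n" and "invertible_mat P" using basis unfolding jordan_eigenbasis_def by auto
  then obtain Q where Q: "P * Q = 1\<^sub>m n" "Q * P = 1\<^sub>m (dim_row Q)"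
    unfolding invertible_mat_def inverts_mat_def by auto
  have Qc: "Q \<in> carrier_mat n n"
  proof (rule carrier_matI)
    show "dim_col Q = n" using arg_cong[OF Q(1), of dim_col] by simp
    show "dim_row Q = n" using arg_cong[OF Q(2), of dim_col] P by simp
  qed
  have len: "length l = n"
    using degree_monic_char_poly[OF Ac] degree_linear_factors[of uminus l] ev
    unfolding ordered_eigenvalues_def by simp
  have mono: "cmod (l ! j) \<le> cmod (l ! i)" if "i \<le> j" "j < n" for i j
    using ev that len unfolding ordered_eigenvalues_def by simp
  \<comment> \<open>One formula covers both kinds of column: \<open>c i\<close> is zero for an
    eigenvector. At \<open>i = 0\<close> the truncated index points to column 0 itself, with
    coefficient zero.\<close>
  have "\<exists>c. \<forall>i<n. (i = 0 \<or> l ! i \<noteq> l ! (i - 1) \<longrightarrow> c i = 0) \<and>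
      ?A *\<^sub>v col P i = l ! i \<cdot>\<^sub>v col P i + c i \<cdot>\<^sub>v col P (i - 1)"
  proof -
    have "\<exists>c. (i = 0 \<or> l ! i \<noteq> l ! (i - 1) \<longrightarrow> c = 0) \<and>
      ?A *\<^sub>v col P i = l ! i \<cdot>\<^sub>v col P i + c \<cdot>\<^sub>v col P (i - 1)" if i: "i < n" for i
    proof (cases "?A *\<^sub>v col P i = l ! i \<cdot>\<^sub>v col P i")
      case True
      have "l ! i \<cdot>\<^sub>v col P i = l ! i \<cdot>\<^sub>v col P i + 0 \<cdot>\<^sub>v col P (i - 1)" by (intro eq_vecI) auto
      then show ?thesis using True by (intro exI[of _ 0]) simp
    next
      case False
      then show ?thesis using basis i unfolding jordan_eigenbasis_def by force
    qed
    then show ?thesis by metis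
  qed
  then obtain c where c0: "\<And>i. i < n \<Longrightarrow> i = 0 \<or> l ! i \<noteq> l ! (i - 1) \<Longrightarrow> c i = 0"
    and c: "\<And>i. i < n \<Longrightarrow> ?A *\<^sub>v col P i = l ! i \<cdot>\<^sub>v col P i + c i \<cdot>\<^sub>v col P (i - 1)" by blast
  have "?A * P = P * bidiag_mat n (\<lambda>i. l ! i) c"
  proof (rule eq_matI)
    fix i j assume "i < dim_row (P * bidiag_mat n (\<lambda>i. l ! i) c)" "j < dim_col (P * bidiag_mat n (\<lambda>i. l ! i) c)"
    then have ij: "i < n" "j < n" using P by (auto simp: bidiag_mat_def)
    have "(?A * P) $$ (i, j) = (?A *\<^sub>v col P j) $ i" using Ac P ij by simp
    also have "\<dots> = l ! j * P $$ (i, j) + c j * P $$ (i, j - 1)" unfolding c[OF ij(2)] using P ij by simp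
    also have "\<dots> = (P * bidiag_mat n (\<lambda>i. l ! i) c) $$ (i, j)"
      using mult_bidiag_mat[OF P ij, of "\<lambda>i. l ! i" c] c0[OF ij(2)] by auto
    finally show "(?A * P) $$ (i, j) = (P * bidiag_mat n (\<lambda>i. l ! i) c) $$ (i, j)" .
  qed (use P Ac in \<open>auto simp: bidiag_mat_def\<close>)
  moreover have "cmod (l ! j) < cmod (l ! i)" if "i < m" "m \<le> j" "j < n" for i j
  proof -
    have "cmod (l ! j) \<le> cmod (l ! m)" using mono that by simp
    also have "\<dots> < cmod (l ! (m - 1))" by (rule gap)
    also have "\<dots> \<le> cmod (l ! i)" using mono[of i "m - 1"] m that by simp
    finally show ?thesis .
  qed
  moreover have "c m = 0" by (rule c0[OF m(2)]) (use gap in force)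
  ultimately have "real_bidiagonal_form n m (\<lambda>i. l ! i) c A P Q"
    using m A P Q Qc by unfold_locales auto
  then show ?thesis by blast
qed

theorem theorem3:
  fixes A :: "real mat" and P :: "complex mat" and l :: "complex list"
    and U :: "nat \<Rightarrow> real mat" and n m r :: nat
  assumes "1 \<le> r" and "r \<le> n - 1"
    and "A \<in> carrier_mat n n"
    and "ordered_eigenvalues (map_mat complex_of_real A) l"
    and "jordan_eigenbasis n (map_mat complex_of_real A) l P"
    and "m \<in> {r..n - 1}"
    and "cmod (l ! (m - 1)) > cmod (l ! m)"
    and "U 0 \<in> admissible_set P n m r"
    and "natural_power_solution A U"
  shows "converges_to_set U (limit_set P n m r) \<and> invariant_set A (limit_set P n m r)"
proof -
  have "0 < m" "m < n" using assms(1,2,6) by auto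
  from jordan_eigenbasis_bidiagonal_form[OF assms(3-5) this assms(7)]
  obtain c Q where "real_bidiagonal_form n m (\<lambda>i. l ! i) c A P Q" by blast
  then interpret real_bidiagonal_form n m "\<lambda>i. l ! i" c A P Q .
  \<comment> \<open>Here the full rank of \<open>K\<close> enters; from now on only the evolution of
    \<open>Z\<close> matters.\<close>
  obtain Z where Z: "mat_on_graph r Z (U 0)" using admissible_set_on_graph[OF assms(8)] by blast
  have "U 0 \<in> stiefel r n" using assms(8) unfolding admissible_set_def by simp
  note U = natural_power_solution_on_graph[OF assms(9) this Z]
  have "converges_to_set U (limit_set P n m r)"
    by (rule natural_power_converges[of U r Z]) (use U in auto)
  then show ?thesis using limit_set_invariant by simp
qed

end
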